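(* Let $y\sim\mathcal{N}(\mu,\sigma^2I_n)$, let $\hat E(y)=(\hat S,\hat s)$ be the outcome of marginal screening with model size $k$, and let $\alpha\in(0,1)$. For $j\in\hat S$, let $L_\alpha=L_\alpha(\eta_j,(\hat S,\hat s))$ and $U_\alpha=U_\alpha(\eta_j,(\hat S,\hat s))$ be the (almost surely unique) real values satisfying $$ F^{[\mathcal{V}^-,\mathcal{V}^+]}_{L_\alpha,\ \sigma^2\|\eta_j\|_2^2}(\eta_j^Ty)=1-\frac{\alpha}{2},\qquad F^{[\mathcal{V}^-,\mathcal{V}^+]}_{U_\alpha,\ \sigma^2\|\eta_j\|_2^2}(\eta_j^Ty)=\frac{\alpha}{2}. $$ Then $[L_\alpha,U_\alpha]$ is a $(1-\alpha)$ confidence interval for $\beta^\star_{j\in\hat S}$ conditional on $\hat E$: for every value $E=(S,s)$ with $\Pr(\hat E(y)=E)>0$ and every $j\in S$, $$ \Pr\left(\beta^\star_{j\in\hat S}\in[L_\alpha,U_\alpha]\ \big|\ \{\hat E(y)=E\}\right)=1-\alpha. $$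
   Context: Setting: $X\in\mathbb{R}^{n\times p}$ is a fixed (non-random) design matrix with columns $x_1,\dots,x_p\in\mathbb{R}^n$ of unit Euclidean norm, in general position: any set of at most $\min(n,p)$ columns is linearly independent, and $x_i\neq\pm x_j$ for $i\ne j$. The response is $y=\mu+\epsilon$ with $\mu\in\mathbb{R}^n$ an arbitrary fixed vector and $\epsilon\sim\mathcal{N}(0,\sigma^2 I_n)$, $\sigma^2>0$ known. The model size $k$ is a fixed integer with $1\le k\le\min(n,p)$. Marginal screening: $\hat S=\hat S(y)$ is the set of indices of the $k$ largest entries of $(|x_1^Ty|,\dots,|x_p^Ty|)$, and $\hat s\in\{\pm1\}^{\hat S}$ is given by $\hat s_i=\mathrm{sign}(x_i^Ty)$, $i\in\hat S$. (Ties and zero correlations have probability zero and may be resolved arbitrarily.) Write $\hat E(y)=(\hat S,\hat s)$. For $S\subset\{1,\dots,p\}$ with $|S|=k$, $X_S$ is the submatrix of columns indexed by $S$, $\beta^\star_S=(X_S^TX_S)^{-1}X_S^T\mu$, and $\beta^\star_{j\in S}$ is the coordinate of $\beta^\star_S$ corresponding to the variable $j\in S$. With $e_j$ the standard basis vector of $\mathbb{R}^S$ for $j\in S$, put $\eta_j=X_{\hat S}(X_{\hat S}^TX_{\hat S})^{-1}e_j=(X_{\hat S}^T)^\dagger e_j$, so that $\eta_j^T\mu=\beta^\star_{j\in\hat S}$. For $s\in\{\pm1\}^S$, $A(S,s)$ is the matrix with rows $(x_l-s_ix_i)^T$ and $(-x_l-s_ix_i)^T$ for $i\in S$, $l\notin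 S$, and $-s_ix_i^T$ for $i\in S$; $b(S,s)=0$. Thus, up to null sets, $\{\hat E(y)=(S,s)\}=\{A(S,s)y\le b(S,s)\}$. With $A=A(\hat S,\hat s)$, $b=b(\hat S,\hat s)$, $\eta=\eta_j$ and $c=A\eta/\|\eta\|_2^2$, define $$ \mathcal{V}^-=\max_{l:\,c_l<0}\frac{b_l-(Ay)_l+c_l\,\eta^Ty}{c_l},\qquad \mathcal{V}^+=\min_{l:\,c_l>0}\frac{b_l-(Ay)_l+c_l\,\eta^Ty}{c_l}, $$ with an empty max equal to $-\infty$ and an empty min equal to $+\infty$. For $-\infty\le v<w\le\infty$, $F^{[v,w]}_{m,\tau^2}$ is the CDF of the $\mathcal{N}(m,\tau^2)$ distribution truncated to $[v,w]$: $$F^{[v,w]}_{m,\tau^2}(t)=\frac{\Phi((t-m)/\tau)-\Phi((v-m)/\tau)}{\Phi((w-m)/\tau)-\Phi((v-m)/\tau)},$$ where $\Phi$ is the standard normal CDF. *)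

theory Defs
  imports "HOL-Probability.Probability"
begin

definition general_position :: "real^'p^'n \<Rightarrow> bool" where
  "general_position X \<longleftrightarrow>
     (\<forall>T :: 'p set. card T \<le> min CARD('n) CARD('p) \<longrightarrow> independent ((\<lambda>i. column i X) ` T)) \<and>
     (\<forall>i j. i \<noteq> j \<longrightarrow> column i X \<noteq> column j X \<and> column i X \<noteq> - column j X)"
  (* the second clause makes i \<mapsto> column i X injective, so that independence of the image set
     is linear independence of the columns as a family *)

definition iso_normal_density :: "real^'n \<Rightarrow> real \<Rightarrow> real^'n \<Rightarrow> real" where
  "iso_normal_density \<mu> \<sigma> z = (\<Prod>i\<in>UNIV. normal_density (\<mu> $ i) \<sigma> (z $ i))"
  (* Lebesgue density of N(\<mu>, \<sigma>^2 I_n); the second argument is the standard deviation *)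

text \<open>
  As S is random, an S-indexed object cannot get its own type.  An n-by-S matrix is represented by
  an n-by-p matrix that vanishes in the columns outside S, and an S-by-S matrix by a p-by-p matrix
  that vanishes outside the S-by-S block.  Sums and products then agree with those of the
  S-indexed matrices.
\<close>

definition submatrix_cols :: "real^'p^'n \<Rightarrow> 'p set \<Rightarrow> real^'p^'n" where
  "submatrix_cols X S = (\<chi> i j. if j \<in> S then X $ i $ j else 0)"

definition mat_one_on :: "'p set \<Rightarrow> real^'p^'p" where
  "mat_one_on S = (\<chi> i j. if i = j \<and> i \<in> S then 1 else 0)"

definition matrix_inv_on :: "'p set \<Rightarrow> real^'p^'p \<Rightarrow> real^'p^'p" where
  "matrix_inv_on S G = (THE B. (\<forall>i j. i \<notin> S \<or> j \<notin> S \<longrightarrow> B $ i $ j = 0) \<and>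
                               B ** G = mat_one_on S \<and> G ** B = mat_one_on S)"

definition gram_inv :: "real^'p^'n \<Rightarrow> 'p set \<Rightarrow> real^'p^'p" where
  "gram_inv X S = matrix_inv_on S (transpose (submatrix_cols X S) ** submatrix_cols X S)"

definition beta_star :: "real^'p^'n \<Rightarrow> real^'n \<Rightarrow> 'p set \<Rightarrow> real^'p" where
  "beta_star X \<mu> S = gram_inv X S *v (transpose (submatrix_cols X S) *v \<mu>)"

definition eta :: "real^'p^'n \<Rightarrow> 'p set \<Rightarrow> 'p \<Rightarrow> real^'n" where
  "eta X S j = submatrix_cols X S *v (gram_inv X S *v axis j 1)"

definition marginal_screening_outcome ::
    "real^'p^'n \<Rightarrow> nat \<Rightarrow> real^'n \<Rightarrow> 'p set \<times> ('p \<Rightarrow> real) \<Rightarrow> bool" where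
  "marginal_screening_outcome X k z = (\<lambda>(S, s).
     card S = k \<and>
     (\<forall>i\<in>S. \<forall>l\<in>- S. \<bar>column l X \<bullet> z\<bar> \<le> \<bar>column i X \<bullet> z\<bar>) \<and>
     s \<in> S \<rightarrow>\<^sub>E {-1, 1} \<and>
     (\<forall>i\<in>S. column i X \<bullet> z \<noteq> 0 \<longrightarrow> s i = sgn (column i X \<bullet> z)))"
  (* a relation rather than a function: at a tie or a zero correlation several outcomes are
     admissible.  Sign vectors are extensional on S, so that equality of outcomes is equality
     on S. *)

datatype 'p constraint = Minus_Row 'p 'p | Plus_Row 'p 'p | Sign_Row 'p

definition constraint_rows :: "'p set \<Rightarrow> 'p constraint set" where
  "constraint_rows S = {Minus_Row l i | l i. l \<notin> S \<and> i \<in> S} \<union>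
                       {Plus_Row l i | l i. l \<notin> S \<and> i \<in> S} \<union>
                       {Sign_Row i | i. i \<in> S}"

fun constraint_A :: "real^'p^'n \<Rightarrow> ('p \<Rightarrow> real) \<Rightarrow> 'p constraint \<Rightarrow> real^'n" where
  "constraint_A X s (Minus_Row l i) = column l X - s i *\<^sub>R column i X"
| "constraint_A X s (Plus_Row l i) = - column l X - s i *\<^sub>R column i X"
| "constraint_A X s (Sign_Row i) = - (s i *\<^sub>R column i X)"

definition constraint_b :: "'p constraint \<Rightarrow> real" where
  "constraint_b r = 0"

definition constraint_c :: "real^'p^'n \<Rightarrow> ('p \<Rightarrow> real) \<Rightarrow> real^'n \<Rightarrow> 'p constraint \<Rightarrow> real" where
  "constraint_c X s h r = (constraint_A X s r \<bullet> h) / (norm h)\<^sup>2"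

definition constraint_limit ::
    "real^'p^'n \<Rightarrow> ('p \<Rightarrow> real) \<Rightarrow> real^'n \<Rightarrow> real^'n \<Rightarrow> 'p constraint \<Rightarrow> real" where
  "constraint_limit X s h z r =
     (constraint_b r - constraint_A X s r \<bullet> z + constraint_c X s h r * (h \<bullet> z))
       / constraint_c X s h r"

(* Sup and Inf in ereal are the maximum and minimum of the finite sets below, with the values
   -\<infinity> and \<infinity> on the empty set. *)

definition V_minus :: "real^'p^'n \<Rightarrow> 'p set \<times> ('p \<Rightarrow> real) \<Rightarrow> real^'n \<Rightarrow> real^'n \<Rightarrow> ereal" where
  "V_minus X E h z = (case E of (S, s) \<Rightarrow>
     SUP r\<in>{r \<in> constraint_rows S. constraint_c X s h r < 0}. ereal (constraint_limit X s h z r))"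

definition V_plus :: "real^'p^'n \<Rightarrow> 'p set \<times> ('p \<Rightarrow> real) \<Rightarrow> real^'n \<Rightarrow> real^'n \<Rightarrow> ereal" where
  "V_plus X E h z = (case E of (S, s) \<Rightarrow>
     INF r\<in>{r \<in> constraint_rows S. constraint_c X s h r > 0}. ereal (constraint_limit X s h z r))"

definition std_normal_cdf :: "ereal \<Rightarrow> real" where
  "std_normal_cdf x = measure std_normal_distribution {t. ereal t \<le> x}"

definition trunc_normal_cdf :: "ereal \<Rightarrow> ereal \<Rightarrow> real \<Rightarrow> real \<Rightarrow> real \<Rightarrow> real" where
  "trunc_normal_cdf v w m \<tau>2 t =
     (let N = (\<lambda>x :: ereal. std_normal_cdf ((x - ereal m) / ereal (sqrt \<tau>2)))
      in (N (ereal t) - N v) / (N w - N v))"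

definition pivot_eq ::
    "real^'p^'n \<Rightarrow> real \<Rightarrow> 'p set \<times> ('p \<Rightarrow> real) \<Rightarrow> 'p \<Rightarrow> real^'n \<Rightarrow> real \<Rightarrow> real \<Rightarrow> bool" where
  "pivot_eq X \<sigma> E j z q m \<longleftrightarrow>
     (let h = eta X (fst E) j
      in trunc_normal_cdf (V_minus X E h z) (V_plus X E h z) m (\<sigma>\<^sup>2 * (norm h)\<^sup>2) (h \<bullet> z) = q)"

definition L_limit ::
    "real^'p^'n \<Rightarrow> real \<Rightarrow> real \<Rightarrow> 'p set \<times> ('p \<Rightarrow> real) \<Rightarrow> 'p \<Rightarrow> real^'n \<Rightarrow> real" where
  "L_limit X \<sigma> \<alpha> E j z = (THE m. pivot_eq X \<sigma> E j z (1 - \<alpha> / 2) m)"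

definition U_limit ::
    "real^'p^'n \<Rightarrow> real \<Rightarrow> real \<Rightarrow> 'p set \<times> ('p \<Rightarrow> real) \<Rightarrow> 'p \<Rightarrow> real^'n \<Rightarrow> real" where
  "U_limit X \<sigma> \<alpha> E j z = (THE m. pivot_eq X \<sigma> E j z (\<alpha> / 2) m)"

end

theory Submission
  imports Defs
begin

text \<open>
  Up to null sets the outcome \<open>(S, s)\<close> is the polyhedral event that all constraints hold strictly.  On a
  line in direction \<open>\<eta>\<close> this event is the interval between \<open>V\<^sup>-\<close> and \<open>V\<^sup>+\<close> or empty, and these limits
  are constant on the line; the density of \<open>y\<close> restricted to the line is a multiple of the density of
  \<open>\<eta> \<bullet> y\<close>.  Hence the pivot \<open>F\<close> with mean \<open>\<eta> \<bullet> \<mu> = \<beta>\<^sup>\<star>\<close> is uniform on every line, and integrating over the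
  lines it is uniform given the outcome.  As \<open>F\<close> is strictly decreasing and continuous in the mean,
  with limits 1 and 0, \<open>L \<le> \<beta>\<^sup>\<star> \<le> U\<close> means that the pivot lies between \<open>\<alpha> / 2\<close> and \<open>1 - \<alpha> / 2\<close>.
\<close>

section \<open>Lebesgue integrals along parallel lines\<close>

text \<open>The classical route conditions on the part of \<open>y\<close> orthogonal to
  \<open>eta\<close> and uses its independence of \<open>eta \<bullet> y\<close>. Here it suffices
  to show that one integral over the whole space is 1 - \<alpha> times another, so equality on every
  line is enough: the orthogonal part contributes to each line integral a constant factor common to
  both sides, which is never evaluated. \<open>Ehat\<close> may resolve ties and zero correlations
  in any measurable way. It can differ from the strict polyhedral event only on finitely many
  hyperplanes through the origin, and these are null because general position and unit norms make
  their normals nonzero. The limits \<open>L_limit\<close> and \<open>U_limit\<close> are definite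
  descriptions of solutions of an equation. Measurability is therefore obtained for the coverage
  event, which is traded for two inequalities on the pivot, and not for the limits themselves. The
  behaviour of \<open>F\<close> for large positive and negative means is read off from likelihood
  ratios, an argument that treats finite and infinite truncation points alike.\<close>

lemma nn_integral_lborel_translate:
  fixes f :: "'a::euclidean_space \<Rightarrow> ennreal"
  assumes [measurable]: "f \<in> borel_measurable borel"
  shows "(\<integral>\<^sup>+z. f (c + z) \<partial>lborel) = (\<integral>\<^sup>+z. f z \<partial>lborel)"
proof -
  have "(\<integral>\<^sup>+z. f z \<partial>lborel) = (\<integral>\<^sup>+z. f z \<partial>distr lborel borel ((+) c))"
    by (simp add: lborel_distr_plus)
  also have "\<dots> = (\<integral>\<^sup>+z. f (c + z) \<partial>lborel)"
    by (subst nn_integral_distr) auto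
  finally show ?thesis by simp
qed

text \<open>
  The weight has integral 1 along every line parallel to \<open>h\<close>, so inserting it and applying Fubini
  and translation invariance disintegrates Lebesgue measure along \<open>h\<close> without a rotation.
\<close>
lemma nn_integral_lborel_lines:
  fixes f :: "'a::euclidean_space \<Rightarrow> ennreal" and h :: 'a
  assumes [measurable]: "f \<in> borel_measurable borel" and h: "h \<noteq> 0"
  shows "(\<integral>\<^sup>+z. f z \<partial>lborel) =
    (\<integral>\<^sup>+z. ennreal (std_normal_density (h \<bullet> z / (h \<bullet> h))) * (\<integral>\<^sup>+r. f (z + r *\<^sub>R h) \<partial>lborel) \<partial>lborel)"
proof -
  define w where "w z = ennreal (std_normal_density (h \<bullet> z / (h \<bullet> h)))" for z
  have [measurable]: "w \<in> borel_measurable borel" unfolding w_def by measurable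
  have w1: "(\<integral>\<^sup>+r. w (z - r *\<^sub>R h) \<partial>lborel) = 1" for z
  proof -
    have "w (z - r *\<^sub>R h) = ennreal (normal_density (h \<bullet> z / (h \<bullet> h)) 1 r)" for r
      using h by (simp add: w_def normal_density_def inner_diff_right diff_divide_distrib power2_commute)
    moreover have "(\<integral>\<^sup>+r. ennreal (normal_density (h \<bullet> z / (h \<bullet> h)) 1 r) \<partial>lborel) = 1"
      by (subst nn_integral_eq_integral) (auto simp: integrable_normal_density integral_normal_density)
    ultimately show ?thesis by simp
  qed
  have "(\<integral>\<^sup>+z. f z \<partial>lborel) = (\<integral>\<^sup>+z. \<integral>\<^sup>+r. f z * w (z - r *\<^sub>R h) \<partial>lborel \<partial>lborel)"
    by (simp add: nn_integral_cmult w1)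
  also have "\<dots> = (\<integral>\<^sup>+r. \<integral>\<^sup>+z. f z * w (z - r *\<^sub>R h) \<partial>lborel \<partial>lborel)"
    by (rule lborel_pair.Fubini') simp
  also have "\<dots> = (\<integral>\<^sup>+r. \<integral>\<^sup>+z. f (z + r *\<^sub>R h) * w z \<partial>lborel \<partial>lborel)"
  proof (rule nn_integral_cong)
    fix r :: real
    show "(\<integral>\<^sup>+z. f z * w (z - r *\<^sub>R h) \<partial>lborel) = (\<integral>\<^sup>+z. f (z + r *\<^sub>R h) * w z \<partial>lborel)"
      using nn_integral_lborel_translate[of "\<lambda>z. f z * w (z - r *\<^sub>R h)" "r *\<^sub>R h"]
      by (simp add: add.commute)
  qed
  also have "\<dots> = (\<integral>\<^sup>+z. \<integral>\<^sup>+r. f (z + r *\<^sub>R h) * w z \<partial>lborel \<partial>lborel)"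
    by (rule lborel_pair.Fubini'[symmetric]) simp
  also have "\<dots> = (\<integral>\<^sup>+z. w z * (\<integral>\<^sup>+r. f (z + r *\<^sub>R h) \<partial>lborel) \<partial>lborel)"
    by (intro nn_integral_cong) (subst nn_integral_multc, auto simp: mult.commute)
  finally show ?thesis by (simp add: w_def)
qed

text \<open>By the disintegration an integral depends only on the integrals along the lines. A line
  integral does not depend on the base point chosen on the line, so the base point may be moved to
  the hyperplane orthogonal to \<open>h\<close>.\<close>

lemma nn_integral_lborel_eqI_lines:
  fixes f g :: "'a::euclidean_space \<Rightarrow> ennreal" and h :: 'a
  assumes "f \<in> borel_measurable borel" "g \<in> borel_measurable borel" "h \<noteq> 0"
    and "\<And>u. h \<bullet> u = 0 \<Longrightarrow> (\<integral>\<^sup>+r. f (u + r *\<^sub>R h) \<partial>lborel) = (\<integral>\<^sup>+r. g (u + r *\<^sub>R h) \<partial>lborel)"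
  shows "(\<integral>\<^sup>+z. f z \<partial>lborel) = (\<integral>\<^sup>+z. g z \<partial>lborel)"
proof -
  have shift: "(\<integral>\<^sup>+r. F (z + r *\<^sub>R h) \<partial>lborel) =
      (\<integral>\<^sup>+r. F ((z - (h \<bullet> z / (h \<bullet> h)) *\<^sub>R h) + r *\<^sub>R h) \<partial>lborel)"
    if [measurable]: "F \<in> borel_measurable borel" for F :: "'a \<Rightarrow> ennreal" and z
    using nn_integral_lborel_translate[of "\<lambda>r. F (z + r *\<^sub>R h)" "- (h \<bullet> z / (h \<bullet> h))"]
    by (simp add: algebra_simps)
  have "(\<integral>\<^sup>+r. f (z + r *\<^sub>R h) \<partial>lborel) = (\<integral>\<^sup>+r. g (z + r *\<^sub>R h) \<partial>lborel)" for z
    unfolding shift[OF assms(1), of z] shift[OF assms(2), of z]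
    using assms(3) by (intro assms(4)) (simp add: inner_diff_right)
  then show ?thesis
    unfolding nn_integral_lborel_lines[OF assms(1,3)] nn_integral_lborel_lines[OF assms(2,3)] by simp
qed

section \<open>Truncated normal distributions\<close>

definition normal_measure :: "real \<Rightarrow> real \<Rightarrow> real measure" where
  "normal_measure m \<tau> = density lborel (\<lambda>x. ennreal (normal_density m \<tau> x))"

lemma sets_normal_measure [simp, measurable_cong]: "sets (normal_measure m \<tau>) = sets borel"
  and space_normal_measure [simp]: "space (normal_measure m \<tau>) = UNIV"
  by (simp_all add: normal_measure_def)

lemma prob_space_normal_measure: "0 < \<tau> \<Longrightarrow> prob_space (normal_measure m \<tau>)"
  unfolding normal_measure_def by (rule prob_space_normal_density)

lemma measure_normal_measure:
  assumes "0 < \<tau>" "A \<in> sets borel"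
  shows "measure (normal_measure m \<tau>) A = (\<integral>x. indicator A x * normal_density m \<tau> x \<partial>lborel)"
proof -
  have "emeasure (normal_measure m \<tau>) A = (\<integral>\<^sup>+x. ennreal (indicator A x * normal_density m \<tau> x) \<partial>lborel)"
    unfolding normal_measure_def using assms
    by (auto simp: emeasure_density intro!: nn_integral_cong split: split_indicator)
  then show ?thesis
    using assms by (subst integral_eq_nn_integral) (auto simp: measure_def)
qed

text \<open>The affine standardisation respects the order on the extended line as well, so infinite
  truncation points need no separate treatment afterwards.\<close>

lemma std_normal_cdf_standardize:
  assumes "0 < \<tau>"
  shows "std_normal_cdf ((x - ereal m) / ereal \<tau>) = measure (normal_measure m \<tau>) {t. ereal t \<le> x}"
proof -
  interpret prob_space "normal_measure m \<tau>" by (rule prob_space_normal_measure[OF assms])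
  have "distributed (normal_measure m \<tau>) lborel (\<lambda>x. x) (normal_density m \<tau>)"
    by (auto simp: distributed_def normal_measure_def distr_id2)
  then have "distributed (normal_measure m \<tau>) lborel (\<lambda>x. (x - m) / \<tau>) std_normal_density"
    using normal_standard_normal_convert[OF assms, of "\<lambda>x. x" m] by simp
  then have D: "std_normal_distribution = distr (normal_measure m \<tau>) lborel (\<lambda>x. (x - m) / \<tau>)"
    by (simp add: distributed_def)
  have eq: "ereal ((t - m) / \<tau>) \<le> (x - ereal m) / ereal \<tau> \<longleftrightarrow> ereal t \<le> x" for t
    using assms by (cases x) (auto simp: divide_right_mono divide_le_cancel)
  show ?thesis
    unfolding std_normal_cdf_def D
    by (subst measure_distr) (auto simp: eq vimage_def)
qed

lemma normal_measure_pos: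
  assumes "0 < \<tau>" "a < b" "{a<..<b} \<subseteq> S" "S \<in> sets borel"
  shows "0 < measure (normal_measure m \<tau>) S"
proof -
  interpret prob_space "normal_measure m \<tau>" by (rule prob_space_normal_measure[OF assms(1)])
  have "emeasure (normal_measure m \<tau>) {a<..<b} \<noteq> 0"
  proof
    assume "emeasure (normal_measure m \<tau>) {a<..<b} = 0"
    then have "AE x in lborel. x \<notin> {a<..<b}"
      using assms(1) unfolding normal_measure_def
      by (subst (asm) emeasure_density) (auto simp: nn_integral_0_iff_AE indicator_eq_0_iff normal_density_pos
          less_imp_neq[symmetric] simp del: greaterThanLessThan_iff)
    moreover have "{x \<in> space lborel. x \<in> {a<..<b}} = {a<..<b}" by auto
    ultimately have "emeasure lborel {a<..<b} = 0"
      using emeasure_eq_0_AE[of "\<lambda>x. x \<in> {a<..<b}" lborel] by simp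
    then show False using assms(2) by simp
  qed
  then have "0 < prob {a<..<b}" by (simp add: emeasure_eq_measure zero_less_measure_iff)
  also have "\<dots> \<le> prob S" using assms by (intro finite_measure_mono) auto
  finally show ?thesis .
qed

lemma normal_measure_singleton:
  "measure (normal_measure m \<tau>) {x} = 0"
proof -
  have "AE y in lborel. y \<noteq> x" by (rule AE_lborel_singleton)
  then have "emeasure (normal_measure m \<tau>) {x} = 0"
    unfolding normal_measure_def
    by (subst emeasure_density) (auto simp: nn_integral_0_iff_AE split: split_indicator)
  then show ?thesis by (simp add: measure_def)
qed

text \<open>The argument is extended real because the truncation limits may be infinite.\<close>

definition normal_ecdf :: "real \<Rightarrow> real \<Rightarrow> ereal \<Rightarrow> real" where
  "normal_ecdf m \<tau> x = measure (normal_measure m \<tau>) {t. ereal t \<le> x}"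

lemma ereal_Collect_borel [measurable]:
  "{t. ereal t \<le> x} \<in> sets borel" "{t. ereal t < x} \<in> sets borel"
  "{t. x < ereal t} \<in> sets borel" "{t. x \<le> ereal t} \<in> sets borel"
  by measurable

context
  fixes \<tau> :: real
  assumes \<tau>: "0 < \<tau>"
begin

lemma trunc_normal_cdf_ecdf:
  "trunc_normal_cdf v w m (\<tau>\<^sup>2) t =
    (normal_ecdf m \<tau> (ereal t) - normal_ecdf m \<tau> v) / (normal_ecdf m \<tau> w - normal_ecdf m \<tau> v)"
  using \<tau> by (simp add: trunc_normal_cdf_def Let_def std_normal_cdf_standardize normal_ecdf_def)

lemma normal_ecdf_diff:
  assumes "x \<le> y"
  shows "normal_ecdf m \<tau> y - normal_ecdf m \<tau> x = measure (normal_measure m \<tau>) {t. x < ereal t \<and> ereal t \<le> y}"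
proof -
  interpret prob_space "normal_measure m \<tau>" by (rule prob_space_normal_measure[OF \<tau>])
  have "{t. x < ereal t \<and> ereal t \<le> y} = {t. ereal t \<le> y} - {t. ereal t \<le> x}" by auto
  moreover have "{t. ereal t \<le> x} \<subseteq> {t. ereal t \<le> y}" using assms by (auto intro: order_trans)
  ultimately show ?thesis
    unfolding normal_ecdf_def by (simp add: finite_measure_Diff)
qed

text \<open>No point carries mass. This reconciles the closed half-lines of a CDF with the strict
  inequalities that describe the selection event.\<close>

lemma normal_ecdf_less:
  "measure (normal_measure m \<tau>) {t. ereal t < x} = normal_ecdf m \<tau> x"
proof -
  interpret prob_space "normal_measure m \<tau>" by (rule prob_space_normal_measure[OF \<tau>])
  show ?thesis
  proof (cases x)
    case (real r)
    have "{t. ereal t \<le> x} = {t. ereal t < x} \<union> {r}" using real by auto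
    then have "normal_ecdf m \<tau> x = prob {t. ereal t < x} + prob {r}"
      using real unfolding normal_ecdf_def by (simp only:) (subst finite_measure_Union, auto)
    then show ?thesis by (simp add: normal_measure_singleton)
  qed (auto simp: normal_ecdf_def)
qed

lemma normal_ecdf_strict_mono:
  assumes "x < y"
  shows "normal_ecdf m \<tau> x < normal_ecdf m \<tau> y"
proof -
  obtain a where a: "x < ereal a" "ereal a < y" using ereal_dense2[OF assms] by auto
  obtain b where b: "ereal a < ereal b" "ereal b < y" using ereal_dense2[OF a(2)] by auto
  have "{a<..<b} \<subseteq> {t. x < ereal t \<and> ereal t \<le> y}"
  proof safe
    fix t assume t: "t \<in> {a<..<b}"
    show "x < ereal t" using a(1) t by (elim order.strict_trans) simp
    show "ereal t \<le> y" using b(2) t by (intro less_imp_le) (elim order.strict_trans[rotated], simp)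
  qed
  then have "0 < measure (normal_measure m \<tau>) {t. x < ereal t \<and> ereal t \<le> y}"
    using b \<tau> by (intro normal_measure_pos[of \<tau> a b]) auto
  then show ?thesis using normal_ecdf_diff[OF less_imp_le[OF assms], of m] by simp
qed

lemma normal_ecdf_le_iff: "normal_ecdf m \<tau> x \<le> normal_ecdf m \<tau> y \<longleftrightarrow> x \<le> y"
  using normal_ecdf_strict_mono[of x y m] normal_ecdf_strict_mono[of y x m]
  by (cases x y rule: linorder_cases) auto

lemma normal_ecdf_less_iff: "normal_ecdf m \<tau> x < normal_ecdf m \<tau> y \<longleftrightarrow> x < y"
  using normal_ecdf_le_iff[of m y x] by (simp add: not_le[symmetric] del: not_le)

lemma normal_ecdf_ereal: "normal_ecdf m \<tau> (ereal x) = cdf (normal_measure m \<tau>) x"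
  by (simp add: normal_ecdf_def cdf_def atMost_def)

lemma isCont_normal_cdf: "isCont (cdf (normal_measure m \<tau>)) x"
proof -
  interpret prob_space "normal_measure m \<tau>" by (rule prob_space_normal_measure[OF \<tau>])
  interpret real_distribution "normal_measure m \<tau>" by standard auto
  show ?thesis by (simp add: isCont_cdf normal_measure_singleton)
qed

text \<open>As \<open>v\<close> and \<open>w\<close> may be infinite, the intermediate value theorem
  is applied to real points far enough out, supplied by the limits of the CDF. Strict monotonicity
  then places the quantile between \<open>v\<close> and \<open>w\<close>.\<close>

lemma normal_ecdf_quantile:
  assumes "normal_ecdf m \<tau> v < q" "q < normal_ecdf m \<tau> w"
  shows "\<exists>x. v < ereal x \<and> ereal x < w \<and> normal_ecdf m \<tau> (ereal x) = q"
proof -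
  interpret prob_space "normal_measure m \<tau>" by (rule prob_space_normal_measure[OF \<tau>])
  interpret real_distribution "normal_measure m \<tau>" by standard auto
  let ?F = "cdf (normal_measure m \<tau>)"
  have "0 < q" "q < 1"
    using assms by (auto simp: normal_ecdf_def intro: le_less_trans[OF measure_nonneg] less_le_trans[OF _ prob_le_1])
  have "eventually (\<lambda>x. ?F x < q) at_bot" "eventually (\<lambda>x. q < ?F x) at_top"
    using order_tendstoD[OF cdf_lim_at_bot] order_tendstoD[OF cdf_lim_at_top_prob] \<open>0 < q\<close> \<open>q < 1\<close> by auto
  then obtain lo hi where *: "\<And>x. x \<le> lo \<Longrightarrow> ?F x < q" "\<And>x. hi \<le> x \<Longrightarrow> q < ?F x"
    by (auto simp: eventually_at_bot_linorder eventually_at_top_linorder)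
  have "?F (min lo hi) < q" "q < ?F (max lo hi)" using * by auto
  then obtain x where x: "?F x = q"
    using IVT[of ?F "min lo hi" q "max lo hi"] isCont_normal_cdf by (meson less_imp_le min.cobounded1 max.cobounded1 order_trans)
  moreover from x assms have "v < ereal x" "ereal x < w"
    by (simp_all add: normal_ecdf_ereal[symmetric] normal_ecdf_less_iff flip: x)
  ultimately show ?thesis by (auto simp: normal_ecdf_ereal)
qed

text \<open>The probability integral transform, multiplied by the mass of the truncation interval so
  that nothing is conditioned. The levels \<open>a\<close> and \<open>b\<close> are attained at
  interior points \<open>xa\<close> and \<open>xb\<close>, hence the event is exactly
  \<open>{xa..xb}\<close>.\<close>

lemma trunc_normal_cdf_uniform:
  assumes "v < w" "0 < a" "a \<le> b" "b < 1"
  shows "measure (normal_measure m \<tau>) {x. v < ereal x \<and> ereal x < w \<and>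
            a \<le> trunc_normal_cdf v w m (\<tau>\<^sup>2) x \<and> trunc_normal_cdf v w m (\<tau>\<^sup>2) x \<le> b} =
         (b - a) * measure (normal_measure m \<tau>) {x. v < ereal x \<and> ereal x < w}"
proof -
  interpret prob_space "normal_measure m \<tau>" by (rule prob_space_normal_measure[OF \<tau>])
  let ?G = "normal_ecdf m \<tau>"
  define p where "p = ?G w - ?G v"
  have p: "0 < p" using normal_ecdf_strict_mono[OF assms(1), of m] by (simp add: p_def)
  have q: "\<exists>x. v < ereal x \<and> ereal x < w \<and> ?G (ereal x) = ?G v + c * p" if "0 < c" "c < 1" for c
  proof (rule normal_ecdf_quantile)
    show "?G v < ?G v + c * p" using that p by simp
    have "c * p < 1 * p" using that p by (intro mult_strict_right_mono) auto
    then show "?G v + c * p < ?G w" by (simp add: p_def)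
  qed
  obtain xa where xa: "v < ereal xa" "ereal xa < w" "?G (ereal xa) = ?G v + a * p"
    using q[of a] assms by auto
  obtain xb where xb: "v < ereal xb" "ereal xb < w" "?G (ereal xb) = ?G v + b * p"
    using q[of b] assms by auto
  have "?G (ereal xa) \<le> ?G (ereal xb)" using xa xb assms p by simp
  then have ab: "ereal xa \<le> ereal xb" by (simp only: normal_ecdf_le_iff)
  have iff: "a \<le> trunc_normal_cdf v w m (\<tau>\<^sup>2) x \<longleftrightarrow> xa \<le> x" "trunc_normal_cdf v w m (\<tau>\<^sup>2) x \<le> b \<longleftrightarrow> x \<le> xb" for x
  proof -
    have "a \<le> trunc_normal_cdf v w m (\<tau>\<^sup>2) x \<longleftrightarrow> ?G (ereal xa) \<le> ?G (ereal x)"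
      unfolding trunc_normal_cdf_ecdf p_def[symmetric] using p xa(3) by (simp add: field_simps)
    then show "a \<le> trunc_normal_cdf v w m (\<tau>\<^sup>2) x \<longleftrightarrow> xa \<le> x" by (simp add: normal_ecdf_le_iff)
    have "trunc_normal_cdf v w m (\<tau>\<^sup>2) x \<le> b \<longleftrightarrow> ?G (ereal x) \<le> ?G (ereal xb)"
      unfolding trunc_normal_cdf_ecdf p_def[symmetric] using p xb(3) by (simp add: field_simps)
    then show "trunc_normal_cdf v w m (\<tau>\<^sup>2) x \<le> b \<longleftrightarrow> x \<le> xb" by (simp add: normal_ecdf_le_iff)
  qed
  have "{x. v < ereal x \<and> ereal x < w \<and>
            a \<le> trunc_normal_cdf v w m (\<tau>\<^sup>2) x \<and> trunc_normal_cdf v w m (\<tau>\<^sup>2) x \<le> b} = {xa..xb}"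
    using xa(1) xb(2) le_less_trans[of "ereal _" "ereal xb" w] less_le_trans[of v "ereal xa" "ereal _"]
    by (auto simp: iff)
  also have "{xa..xb} = {t. ereal t \<le> ereal xb} - {t. ereal t < ereal xa}" by auto
  also have "prob \<dots> = ?G (ereal xb) - ?G (ereal xa)"
    using ab normal_ecdf_less[of m "ereal xa"] by (subst finite_measure_Diff) (auto simp: normal_ecdf_def)
  also have "\<dots> = (b - a) * p" using xa xb by (simp add: algebra_simps)
  also have "p = prob ({t. ereal t < w} - {t. ereal t \<le> v})"
    using assms(1) by (subst finite_measure_Diff) (auto simp: normal_ecdf_less normal_ecdf_def p_def)
  also have "{t. ereal t < w} - {t. ereal t \<le> v} = {x. v < ereal x \<and> ereal x < w}" by auto
  finally show ?thesis .
qed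

text \<open>The likelihood ratio of two normal laws with equal variance is an exponential in
  \<open>x\<close>, increasing when the mean is raised. All comparisons of different means below
  rest on this.\<close>

lemma normal_density_tilt:
  "normal_density m' \<tau> x = exp ((m' - m) * (x - (m + m') / 2) / \<tau>\<^sup>2) * normal_density m \<tau> x"
proof -
  have "- (x - m')\<^sup>2 / (2 * \<tau>\<^sup>2) = (m' - m) * (x - (m + m') / 2) / \<tau>\<^sup>2 + - (x - m)\<^sup>2 / (2 * \<tau>\<^sup>2)"
    using \<tau> by (simp add: field_simps power2_eq_square)
  then have "exp (- (x - m')\<^sup>2 / (2 * \<tau>\<^sup>2)) =
      exp ((m' - m) * (x - (m + m') / 2) / \<tau>\<^sup>2) * exp (- (x - m)\<^sup>2 / (2 * \<tau>\<^sup>2))"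
    by (simp only: exp_add)
  then show ?thesis unfolding normal_density_def by simp
qed

text \<open>To the left of \<open>a\<close> the increasing likelihood ratio is at most its value at
  \<open>a\<close>; the next lemma is the mirror image on the right.\<close>

lemma normal_measure_tilt_le:
  assumes "m \<le> m'" "S \<in> sets borel" "\<And>x. x \<in> S \<Longrightarrow> x \<le> a"
  shows "measure (normal_measure m' \<tau>) S
    \<le> exp ((m' - m) * (a - (m + m') / 2) / \<tau>\<^sup>2) * measure (normal_measure m \<tau>) S"
proof -
  have "(\<integral>x. indicator S x * normal_density m' \<tau> x \<partial>lborel) \<le>
     (\<integral>x. exp ((m' - m) * (a - (m + m') / 2) / \<tau>\<^sup>2) * (indicator S x * normal_density m \<tau> x) \<partial>lborel)"
  proof (rule integral_mono)
    show "integrable lborel (\<lambda>x. indicator S x * normal_density m' \<tau> x)"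
      "integrable lborel (\<lambda>x. exp ((m' - m) * (a - (m + m') / 2) / \<tau>\<^sup>2) * (indicator S x * normal_density m \<tau> x))"
      using assms \<tau> by (auto intro!: integrable_mult_right integrable_real_mult_indicator simp: mult.commute[of "indicator S _"])
    fix x
    show "indicator S x * normal_density m' \<tau> x \<le> exp ((m' - m) * (a - (m + m') / 2) / \<tau>\<^sup>2) * (indicator S x * normal_density m \<tau> x)"
      using assms(1) assms(3)[of x] \<tau>
      by (auto simp: normal_density_tilt[of m' x m] indicator_def intro!: mult_right_mono mult_left_mono divide_right_mono)
  qed
  then show ?thesis using \<tau> assms by (simp add: measure_normal_measure)
qed

lemma normal_measure_tilt_ge:
  assumes "m \<le> m'" "S \<in> sets borel" "\<And>x. x \<in> S \<Longrightarrow> a \<le> x"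
  shows "exp ((m' - m) * (a - (m + m') / 2) / \<tau>\<^sup>2) * measure (normal_measure m \<tau>) S
    \<le> measure (normal_measure m' \<tau>) S"
proof -
  have "(\<integral>x. exp ((m' - m) * (a - (m + m') / 2) / \<tau>\<^sup>2) * (indicator S x * normal_density m \<tau> x) \<partial>lborel)
    \<le> (\<integral>x. indicator S x * normal_density m' \<tau> x \<partial>lborel)"
  proof (rule integral_mono)
    show "integrable lborel (\<lambda>x. indicator S x * normal_density m' \<tau> x)"
      "integrable lborel (\<lambda>x. exp ((m' - m) * (a - (m + m') / 2) / \<tau>\<^sup>2) * (indicator S x * normal_density m \<tau> x))"
      using assms \<tau> by (auto intro!: integrable_mult_right integrable_real_mult_indicator simp: mult.commute[of "indicator S _"])
    fix x
    show "exp ((m' - m) * (a - (m + m') / 2) / \<tau>\<^sup>2) * (indicator S x * normal_density m \<tau> x) \<le> indicator S x * normal_density m' \<tau> x"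
      using assms(1) assms(3)[of x] \<tau>
      by (auto simp: normal_density_tilt[of m' x m] indicator_def intro!: mult_right_mono mult_left_mono divide_right_mono)
  qed
  then show ?thesis using \<tau> assms by (simp add: measure_normal_measure)
qed

end

section \<open>Dependence of the truncated CDF on the mean\<close>

lemma isCont_normal_ecdf_mean:
  assumes "0 < \<tau>"
  shows "isCont (\<lambda>m. normal_ecdf m \<tau> x) m0"
proof (cases x)
  case (real r)
  have "normal_ecdf m \<tau> x = cdf (normal_measure 0 1) ((r - m) / \<tau>)" for m
  proof -
    \<comment> \<open>Standardisation is read twice, with parameters \<open>m\<close>, \<tau> and
      with 0, 1. This moves the mean into the argument of one fixed continuous CDF.\<close>
    have "std_normal_cdf ((x - ereal m) / ereal \<tau>) = std_normal_cdf ((ereal ((r - m) / \<tau>) - ereal 0) / ereal 1)"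
      using real assms by simp
    then show ?thesis
      using assms by (simp only: std_normal_cdf_standardize normal_ecdf_def[symmetric] zero_less_one normal_ecdf_ereal)
  qed
  moreover have "isCont (\<lambda>m. cdf (normal_measure 0 1) ((r - m) / \<tau>)) m0"
    using assms by (intro continuous_intros isCont_o2[OF _ isCont_normal_cdf]) auto
  ultimately show ?thesis by simp
next
  case PInf
  then have "normal_ecdf m \<tau> x = 1" for m
    using prob_space.prob_space[OF prob_space_normal_measure[OF assms]] by (simp add: normal_ecdf_def)
  then show ?thesis by simp
next
  case MInf
  then have "normal_ecdf m \<tau> x = 0" for m by (simp add: normal_ecdf_def)
  then show ?thesis by simp
qed

context
  fixes \<tau> t :: real and v w :: ereal
  assumes \<tau>: "0 < \<tau>" and vt: "v < ereal t" and tw: "ereal t < w"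
begin

text \<open>Written as left mass over left plus right mass, the value is governed by the ratio of
  the two, which tilting controls.\<close>

lemma trunc_normal_cdf_split:
  "trunc_normal_cdf v w m (\<tau>\<^sup>2) t =
    measure (normal_measure m \<tau>) {x. v < ereal x \<and> ereal x \<le> ereal t} /
    (measure (normal_measure m \<tau>) {x. v < ereal x \<and> ereal x \<le> ereal t} +
     measure (normal_measure m \<tau>) {x. ereal t < ereal x \<and> ereal x \<le> w})"
  unfolding trunc_normal_cdf_ecdf[OF \<tau>]
  unfolding normal_ecdf_diff[OF \<tau> less_imp_le[OF vt], symmetric]
    normal_ecdf_diff[OF \<tau> less_imp_le[OF tw], symmetric] by simp

lemma normal_measure_interval_pos:
  assumes "a < (b::ereal)"
  shows "0 < measure (normal_measure m \<tau>) {x. a < ereal x \<and> ereal x \<le> b}"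
  using normal_ecdf_strict_mono[OF \<tau> assms, of m] normal_ecdf_diff[OF \<tau> less_imp_le[OF assms], of m] by simp

lemma normal_measure_interval_split:
  assumes "a \<le> (b::ereal)" "b \<le> c"
  shows "measure (normal_measure m \<tau>) {x. a < ereal x \<and> ereal x \<le> c} =
    measure (normal_measure m \<tau>) {x. a < ereal x \<and> ereal x \<le> b} +
    measure (normal_measure m \<tau>) {x. b < ereal x \<and> ereal x \<le> c}"
  using normal_ecdf_diff[OF \<tau> assms(1), of m] normal_ecdf_diff[OF \<tau> assms(2), of m]
    normal_ecdf_diff[OF \<tau> order_trans[OF assms], of m] by simp

text \<open>
  Raising the mean multiplies the density by an increasing exponential, hence shifts mass from the
  left of \<open>t\<close> to its right relative to the value of that factor at \<open>t\<close>.
\<close>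
lemma trunc_normal_cdf_strict_antimono:
  assumes "m < m'"
  shows "trunc_normal_cdf v w m' (\<tau>\<^sup>2) t < trunc_normal_cdf v w m (\<tau>\<^sup>2) t"
proof -
  \<comment> \<open>Tilting to the right of \<open>t\<close> by the factor at \<open>t\<close> alone
    gives a weak inequality. The mass beyond \<open>a\<close> is multiplied by the strictly larger
    factor \<open>r a\<close>, and this yields strictness.\<close>
  obtain a where a: "t < a" "ereal a < w" using ereal_dense2[OF tw] by auto
  define r where "r x = exp ((m' - m) * (x - (m + m') / 2) / \<tau>\<^sup>2)" for x
  have r: "0 < r t" "r t < r a"
    using assms a \<tau> by (simp_all add: r_def divide_strict_right_mono)
  define N where "N = (\<lambda>m (a::ereal) b. measure (normal_measure m \<tau>) {x. a < ereal x \<and> ereal x \<le> b})"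
  have pos: "0 < N m a b" if "a < b" for m a b
    unfolding N_def by (rule normal_measure_interval_pos[OF that])
  have 1: "N m' v t \<le> r t * N m v t"
    unfolding N_def r_def using assms by (intro normal_measure_tilt_le[OF \<tau>]) auto
  have "r t * (N m t a + N m a w) < r t * N m t a + r a * N m a w"
    using pos[of a w m] a r by (simp add: algebra_simps)
  also have "\<dots> \<le> N m' t a + N m' a w"
    unfolding N_def r_def using assms by (intro add_mono normal_measure_tilt_ge[OF \<tau>]) auto
  finally have 2: "r t * N m t w < N m' t w"
    using normal_measure_interval_split[of t a w] a unfolding N_def by simp
  have "N m' v t * N m t w \<le> r t * N m v t * N m t w"
    using 1 pos[OF tw] by (simp add: less_imp_le mult_right_mono)
  also have "\<dots> < N m v t * N m' t w"
    using mult_strict_left_mono[OF 2 pos[OF vt]] by (simp add: mult_ac)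
  finally have "N m' v t / (N m' v t + N m' t w) < N m v t / (N m v t + N m t w)"
    using add_pos_pos[OF pos[OF vt] pos[OF tw], of m m] add_pos_pos[OF pos[OF vt] pos[OF tw], of m' m']
    by (simp add: divide_less_eq less_divide_eq algebra_simps)
  then show ?thesis by (simp add: trunc_normal_cdf_split N_def)
qed

text \<open>For a large mean the mass left of \<open>t\<close> is negligible against the mass right
  of some \<open>a\<close> beyond \<open>t\<close>: relative to mean 0, the density gains between
  \<open>t\<close> and \<open>a\<close> a factor exponential in the mean.\<close>

lemma ex_mean_trunc_normal_cdf_less:
  assumes "0 < q"
  shows "\<exists>m. trunc_normal_cdf v w m (\<tau>\<^sup>2) t < q"
proof -
  obtain a where a: "t < a" "ereal a < w" using ereal_dense2[OF tw] by auto
  define N where "N = (\<lambda>m (a::ereal) b. measure (normal_measure m \<tau>) {x. a < ereal x \<and> ereal x \<le> b})"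
  have pos: "0 < N m a b" if "a < b" for m a b
    unfolding N_def by (rule normal_measure_interval_pos[OF that])
  have "\<exists>d>0. exp (- d) * N 0 v t < q * N 0 a w"
  proof -
    have "((\<lambda>d. exp (- d) * N 0 v t) \<longlongrightarrow> 0 * N 0 v t) at_top"
      by (intro tendsto_intros filterlim_compose[OF exp_at_bot] filterlim_uminus_at_bot_at_top)
    then have "eventually (\<lambda>d. exp (- d) * N 0 v t < q * N 0 a w) at_top"
      using pos[OF a(2)] assms by (intro order_tendstoD) auto
    then show ?thesis
      using eventually_gt_at_top[of 0] by (metis (mono_tags, lifting) eventually_conj eventually_happens trivial_limit_at_top_linorder)
  qed
  then obtain d where d: "0 < d" "exp (- d) * N 0 v t < q * N 0 a w" by auto
  \<comment> \<open>Solves \<open>m * (a - t) / \<tau>\<^sup>2 = d\<close>, so that the likelihood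
    ratio against mean 0 at \<open>t\<close> is \<open>exp (- d)\<close> times the one at
    \<open>a\<close>.\<close>
  define m where "m = d * \<tau>\<^sup>2 / (a - t)"
  have m: "0 \<le> m" using d a by (simp add: m_def)
  have m_eq: "m * (a - t) / \<tau>\<^sup>2 = d" using a \<tau> by (simp add: m_def)
  define r where "r x = exp ((m - 0) * (x - (0 + m) / 2) / \<tau>\<^sup>2)" for x
  have "(m - 0) * (t - (0 + m) / 2) / \<tau>\<^sup>2 = - d + (m - 0) * (a - (0 + m) / 2) / \<tau>\<^sup>2"
    using m_eq by (simp add: algebra_simps diff_divide_distrib add_divide_distrib)
  then have r: "r t = exp (- d) * r a" unfolding r_def by (simp only: exp_add)
  have "N m v t \<le> r t * N 0 v t"
    unfolding N_def r_def using m by (intro normal_measure_tilt_le[OF \<tau>]) auto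
  also have "\<dots> < q * (r a * N 0 a w)"
    using mult_strict_left_mono[OF d(2), of "r a"] unfolding r by (simp add: r_def mult_ac)
  also have "r a * N 0 a w \<le> N m a w"
    unfolding N_def r_def using m by (intro normal_measure_tilt_ge[OF \<tau>]) auto
  also have "N m a w \<le> N m v t + N m t w"
    using normal_measure_interval_split[of t a w m] a pos[OF vt, of m] pos[of t a m] unfolding N_def by simp
  finally have "N m v t < q * (N m v t + N m t w)" using assms by simp
  then have "N m v t / (N m v t + N m t w) < q"
    using pos[OF vt, of m] pos[OF tw, of m] by (simp add: divide_less_eq)
  then show ?thesis by (auto simp: trunc_normal_cdf_split N_def)
qed

text \<open>The mirror image, with a very negative mean and \<open>a\<close> to the left of
  \<open>t\<close>. Mean 0 is now the larger one, so the tilt runs from \<open>m\<close> up to 0 and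
  \<open>r\<close> sits on the other side of the inequalities.\<close>

lemma ex_mean_trunc_normal_cdf_greater:
  assumes "q < 1"
  shows "\<exists>m. q < trunc_normal_cdf v w m (\<tau>\<^sup>2) t"
proof -
  obtain a where a: "v < ereal a" "a < t" using ereal_dense2[OF vt] by auto
  define N where "N = (\<lambda>m (a::ereal) b. measure (normal_measure m \<tau>) {x. a < ereal x \<and> ereal x \<le> b})"
  have pos: "0 < N m a b" if "a < b" for m a b
    unfolding N_def by (rule normal_measure_interval_pos[OF that])
  have "\<exists>d>0. exp (- d) * N 0 t w < (1 - q) * N 0 v a"
  proof -
    have "((\<lambda>d. exp (- d) * N 0 t w) \<longlongrightarrow> 0 * N 0 t w) at_top"
      by (intro tendsto_intros filterlim_compose[OF exp_at_bot] filterlim_uminus_at_bot_at_top)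
    then have "eventually (\<lambda>d. exp (- d) * N 0 t w < (1 - q) * N 0 v a) at_top"
      using pos[OF a(1)] assms by (intro order_tendstoD) auto
    then show ?thesis
      using eventually_gt_at_top[of 0] by (metis (mono_tags, lifting) eventually_conj eventually_happens trivial_limit_at_top_linorder)
  qed
  then obtain d where d: "0 < d" "exp (- d) * N 0 t w < (1 - q) * N 0 v a" by auto
  define m where "m = - (d * \<tau>\<^sup>2 / (t - a))"
  have m: "m \<le> 0" using d a by (simp add: m_def)
  have m_eq: "m * (t - a) / \<tau>\<^sup>2 = - d" using a \<tau> by (simp add: m_def)
  define r where "r x = exp ((0 - m) * (x - (m + 0) / 2) / \<tau>\<^sup>2)" for x
  have "(0 - m) * (a - (m + 0) / 2) / \<tau>\<^sup>2 = - d + (0 - m) * (t - (m + 0) / 2) / \<tau>\<^sup>2"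
    using m_eq by (simp add: algebra_simps diff_divide_distrib add_divide_distrib)
  then have r: "r a = exp (- d) * r t" unfolding r_def by (simp only: exp_add)
  have rpos: "0 < r t" "0 < r a" by (simp_all add: r_def)
  have "r t * N m t w \<le> N 0 t w"
    unfolding N_def r_def using m by (intro normal_measure_tilt_ge[OF \<tau>]) auto
  then have "r a * N m t w \<le> exp (- d) * N 0 t w"
    by (simp add: r mult.assoc)
  also have "\<dots> < (1 - q) * N 0 v a" by (rule d)
  also have "N 0 v a \<le> r a * N m v a"
    unfolding N_def r_def using m by (intro normal_measure_tilt_le[OF \<tau>]) auto
  also have "N m v a \<le> N m v t + N m t w"
    using normal_measure_interval_split[of v a t m] a pos[OF tw, of m] pos[of a t m] unfolding N_def by simp
  finally have "r a * N m t w < (1 - q) * (r a * (N m v t + N m t w))"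
    using assms rpos by simp
  then have "r a * N m t w < r a * ((1 - q) * (N m v t + N m t w))" by (simp add: mult_ac)
  then have "N m t w < (1 - q) * (N m v t + N m t w)" using rpos by simp
  then have "q < N m v t / (N m v t + N m t w)"
    using pos[OF vt, of m] pos[OF tw, of m] by (simp add: less_divide_eq algebra_simps)
  then show ?thesis by (auto simp: trunc_normal_cdf_split N_def)
qed

lemma isCont_trunc_normal_cdf_mean: "isCont (\<lambda>m. trunc_normal_cdf v w m (\<tau>\<^sup>2) t) m0"
  unfolding trunc_normal_cdf_ecdf[OF \<tau>]
  using normal_ecdf_strict_mono[OF \<tau> order.strict_trans[OF vt tw], of m0]
  by (intro continuous_intros isCont_normal_ecdf_mean[OF \<tau>]) auto

lemma trunc_normal_cdf_mean_le_iff: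
  "trunc_normal_cdf v w m' (\<tau>\<^sup>2) t \<le> trunc_normal_cdf v w m (\<tau>\<^sup>2) t \<longleftrightarrow> m \<le> m'"
  using trunc_normal_cdf_strict_antimono[of m m'] trunc_normal_cdf_strict_antimono[of m' m]
  by (cases m m' rule: linorder_cases) auto

lemma trunc_normal_cdf_mean_ex1:
  assumes "0 < q" "q < 1"
  shows "\<exists>!m. trunc_normal_cdf v w m (\<tau>\<^sup>2) t = q"
proof -
  let ?F = "\<lambda>m. trunc_normal_cdf v w m (\<tau>\<^sup>2) t"
  obtain m1 m2 where m: "?F m1 < q" "q < ?F m2"
    using ex_mean_trunc_normal_cdf_less ex_mean_trunc_normal_cdf_greater assms by blast
  then have "m2 \<le> m1" using trunc_normal_cdf_mean_le_iff[of m1 m2] by simp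
  then obtain m0 where "?F m0 = q"
    using IVT2[of ?F m1 q m2] m isCont_trunc_normal_cdf_mean by (meson less_imp_le)
  moreover have "x = y" if "?F x = q" "?F y = q" for x y
    using trunc_normal_cdf_mean_le_iff[of x y] trunc_normal_cdf_mean_le_iff[of y x] that by simp
  ultimately show ?thesis by blast
qed

end

section \<open>Inverse Gram matrices\<close>

lemma inner_matrix_vector_mult:
  fixes A :: "real^'p^'n"
  shows "u \<bullet> (A *v v) = (transpose A *v u) \<bullet> v"
  by (simp only: dot_lmul_matrix[symmetric] transpose_matrix_vector)

lemma mat_one_on_nth: "mat_one_on S $ i $ j = (if i = j then if j \<in> S then 1 else 0 else 0)"
  by (simp add: mat_one_on_def)

lemma mat_one_on_mult_vec: "(mat_one_on S *v x) $ i = (if i \<in> S then x $ i else 0)"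
  by (cases "i \<in> S") (simp_all add: mat_one_on_def matrix_vector_mult_def if_distrib[of "\<lambda>a. a * _"] cong: if_cong)

lemma matrix_mult_mat_one_on: "(A ** mat_one_on S) $ i $ j = (if j \<in> S then A $ i $ j else (0::real))"
  by (cases "j \<in> S") (simp_all add: mat_one_on_nth matrix_matrix_mult_def if_distrib[of "\<lambda>a. _ * a"] cong: if_cong)

lemma mat_one_on_matrix_mult: "(mat_one_on S ** A) $ i $ j = (if i \<in> S then A $ i $ j else (0::real))"
  by (cases "i \<in> S") (simp_all add: mat_one_on_def matrix_matrix_mult_def if_distrib[of "\<lambda>a. a * _"] cong: if_cong)

lemma submatrix_cols_mult_vec: "submatrix_cols X S *v x = (\<Sum>i\<in>S. x $ i *\<^sub>R column i X)"
proof -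
  have "submatrix_cols X S *v x = (\<Sum>i\<in>UNIV. if i \<in> S then x $ i *\<^sub>R column i X else 0)"
    unfolding matrix_mult_sum
    by (intro sum.cong) (auto simp: submatrix_cols_def column_def vec_eq_iff scalar_mult_eq_scaleR)
  then show ?thesis by (simp add: sum.If_cases)
qed

text \<open>General position speaks of the set of columns. Its second clause makes the columns
  distinct, so coefficients indexed by \<open>S\<close> can be carried to that set through the
  inverse of the column map.\<close>

lemma general_position_kernel:
  fixes X :: "real^'p^'n"
  assumes "general_position X" "card S \<le> min CARD('n) CARD('p)"
    and "submatrix_cols X S *v x = 0" "i \<in> S"
  shows "x $ i = 0"
proof -
  have inj: "inj_on (\<lambda>i. column i X) S"
    using assms(1) by (auto simp: general_position_def inj_on_def)
  have ind: "independent ((\<lambda>i. column i X) ` S)"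
    using assms(1,2) by (auto simp: general_position_def)
  have "(\<Sum>v\<in>(\<lambda>i. column i X) ` S. x $ (the_inv_into S (\<lambda>i. column i X) v) *\<^sub>R v) = 0"
    using assms(3)
    by (simp add: submatrix_cols_mult_vec sum.reindex[OF inj] the_inv_into_f_f[OF inj])
  then have "x $ (the_inv_into S (\<lambda>i. column i X) (column i X)) = 0"
    using ind assms(4) by (auto simp: independent_explicit)
  then show ?thesis by (simp only: the_inv_into_f_f[OF inj assms(4)])
qed

text \<open>\<open>mat_one_on S\<close> is a unit only for matrices supported on the block. With
  this proviso the usual \<open>B = B (G C) = (B G) C = C\<close> applies.\<close>

lemma is_inverse_on_unique:
  fixes B C G :: "real^'p^'p"
  assumes "\<forall>i j. i \<notin> S \<or> j \<notin> S \<longrightarrow> B $ i $ j = 0" "B ** G = mat_one_on S"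
    and "\<forall>i j. i \<notin> S \<or> j \<notin> S \<longrightarrow> C $ i $ j = 0" "G ** C = mat_one_on S"
  shows "B = C"
proof -
  have "B = B ** mat_one_on S" using assms(1) by (auto simp: vec_eq_iff matrix_mult_mat_one_on)
  also have "\<dots> = (B ** G) ** C" by (simp add: assms(4) matrix_mul_assoc[symmetric])
  also have "\<dots> = C" using assms(3) by (auto simp: assms(2) vec_eq_iff mat_one_on_matrix_mult)
  finally show ?thesis .
qed

lemma matrix_inv_on_eqI:
  assumes "\<forall>i j. i \<notin> S \<or> j \<notin> S \<longrightarrow> B $ i $ j = 0" "B ** G = mat_one_on S" "G ** B = mat_one_on S"
  shows "matrix_inv_on S G = B"
  unfolding matrix_inv_on_def
proof (rule the_equality)
  show "(\<forall>i j. i \<notin> S \<or> j \<notin> S \<longrightarrow> B $ i $ j = 0) \<and> B ** G = mat_one_on S \<and> G ** B = mat_one_on S"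
    using assms by blast
qed (elim conjE, rule is_inverse_on_unique[OF _ _ assms(1,3)])

context
  fixes X :: "real^'p^'n" and S :: "'p set"
  assumes gp: "general_position X" and card: "card S \<le> min CARD('n) CARD('p)"
begin

abbreviation "gram \<equiv> transpose (submatrix_cols X S) ** submatrix_cols X S"

lemma gram_nth: "i \<notin> S \<or> j \<notin> S \<Longrightarrow> gram $ i $ j = 0"
  by (auto simp: matrix_matrix_mult_def transpose_def submatrix_cols_def)

text \<open>
  The inverse on the block is cut out of the inverse of the Gram matrix completed by the identity
  outside \<open>S\<close>, which is positive definite.
\<close>
lemma gram_inverse_ex:
  "\<exists>B. (\<forall>i j. i \<notin> S \<or> j \<notin> S \<longrightarrow> B $ i $ j = 0) \<and> B ** gram = mat_one_on S \<and> gram ** B = mat_one_on S"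
proof -
  let ?P = "mat_one_on S :: real^'p^'p"
  define H where "H = gram + (mat 1 - ?P)"
  have PG: "?P ** gram = gram" "gram ** ?P = gram"
    by (simp_all add: vec_eq_iff matrix_mult_mat_one_on mat_one_on_matrix_mult gram_nth)
  have PP: "?P ** ?P = ?P"
    by (auto simp: vec_eq_iff matrix_mult_mat_one_on mat_one_on_nth)
  have PH: "?P ** H = gram" "H ** ?P = gram"
    by (simp_all add: vec_eq_iff matrix_mult_mat_one_on mat_one_on_matrix_mult H_def mat_def mat_one_on_nth gram_nth)
  have "x = 0" if "H *v x = 0" for x
  proof -
    \<comment> \<open>The quadratic form is the squared length of the combination of columns in
      \<open>S\<close> plus the squared length of \<open>x\<close> outside \<open>S\<close>. Both
      vanish on the kernel, and general position disposes of the coordinates in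
      \<open>S\<close>.\<close>
    have "x \<bullet> (H *v x) = x \<bullet> (gram *v x) + (x \<bullet> x - x \<bullet> (?P *v x))"
      by (simp add: H_def matrix_vector_mult_add_rdistrib matrix_vector_mult_diff_rdistrib inner_add_right inner_diff_right)
    also have "x \<bullet> (gram *v x) = (submatrix_cols X S *v x) \<bullet> (submatrix_cols X S *v x)"
      by (simp add: matrix_vector_mul_assoc[symmetric] inner_matrix_vector_mult inner_commute)
    also have "x \<bullet> x - x \<bullet> (?P *v x) = (\<Sum>i\<in>UNIV. if i \<in> S then 0 else (x $ i)\<^sup>2)"
      by (auto simp: inner_vec_def mat_one_on_mult_vec sum_subtractf[symmetric] power2_eq_square intro!: sum.cong)
    finally have "(submatrix_cols X S *v x) \<bullet> (submatrix_cols X S *v x) + (\<Sum>i\<in>UNIV. if i \<in> S then 0 else (x $ i)\<^sup>2) = 0"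
      using that by simp
    moreover have "0 \<le> (\<Sum>i\<in>UNIV. if i \<in> S then 0 else (x $ i)\<^sup>2)" by (intro sum_nonneg) auto
    ultimately have 1: "submatrix_cols X S *v x = 0" and 2: "(\<Sum>i\<in>UNIV. if i \<in> S then 0 else (x $ i)\<^sup>2) = 0"
      by (auto simp: add_nonneg_eq_0_iff)
    show "x = 0"
      unfolding vec_eq_iff
    proof
      fix i
      from 2 have "(if i \<in> S then 0 else (x $ i)\<^sup>2) = 0"
        by (subst (asm) sum_nonneg_eq_0_iff) auto
      then show "x $ i = 0 $ i"
        using general_position_kernel[OF gp card 1] by (auto split: if_splits)
    qed
  qed
  then obtain C where C: "C ** H = mat 1"
    using matrix_left_invertible_ker[of H] by blast
  then have C': "H ** C = mat 1" by (simp add: matrix_left_right_inverse)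
  \<comment> \<open>\<open>C\<close> inherits from \<open>H\<close> that it commutes with the
    projection. Hence \<open>?P ** C\<close>, whose rows outside \<open>S\<close> vanish, also has
    vanishing columns there.\<close>
  have CP: "C ** ?P = ?P ** C"
  proof -
    have "C ** ?P = C ** ?P ** (H ** C)" by (simp add: C')
    also have "\<dots> = C ** (?P ** H) ** C" by (simp only: matrix_mul_assoc)
    also have "?P ** H = H ** ?P" by (simp only: PH)
    also have "C ** (H ** ?P) ** C = (C ** H) ** ?P ** C" by (simp only: matrix_mul_assoc)
    finally have "C ** ?P = (C ** H) ** ?P ** C" .
    also have "\<dots> = ?P ** C" by (simp add: C)
    finally show ?thesis .
  qed
  let ?B = "?P ** C"
  have B0: "?B $ i $ j = 0" if "i \<notin> S \<or> j \<notin> S" for i j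
  proof (cases "i \<in> S")
    case True
    have "?B $ i $ j = (C ** ?P) $ i $ j" by (simp only: CP)
    then show ?thesis using True that by (simp add: matrix_mult_mat_one_on)
  qed (simp add: mat_one_on_matrix_mult)
  have "?B ** gram = ?P ** (C ** H) ** ?P"
    unfolding PH(2)[symmetric] by (simp only: matrix_mul_assoc)
  then have B1: "?B ** gram = ?P" by (simp add: C PP)
  have "gram ** ?B = ?P ** (H ** C) ** ?P"
    unfolding PH(1)[symmetric] CP[symmetric] by (simp only: matrix_mul_assoc)
  then have B2: "gram ** ?B = ?P" by (simp add: C' PP)
  show ?thesis using B0 B1 B2 by blast
qed

lemma gram_inv_props:
  shows gram_inv_nth: "i \<notin> S \<or> j \<notin> S \<Longrightarrow> gram_inv X S $ i $ j = 0"
    and gram_inv_left: "gram_inv X S ** gram = mat_one_on S"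
    and gram_inv_right: "gram ** gram_inv X S = mat_one_on S"
  using gram_inverse_ex matrix_inv_on_eqI[of S _ gram] unfolding gram_inv_def by metis+

text \<open>The Gram matrix is symmetric, so the transpose is a block inverse as well and uniqueness
  applies.\<close>

lemma transpose_gram_inv: "transpose (gram_inv X S) = gram_inv X S"
proof -
  have t1: "transpose (mat_one_on S) = (mat_one_on S :: real^'p^'p)"
    by (auto simp: transpose_def mat_one_on_def vec_eq_iff)
  have t2: "transpose gram = gram" by (simp add: matrix_transpose_mul transpose_transpose)
  show ?thesis
    unfolding gram_inv_def[of X S]
  proof (rule matrix_inv_on_eqI[symmetric])
    show "\<forall>i j. i \<notin> S \<or> j \<notin> S \<longrightarrow> transpose (matrix_inv_on S gram) $ i $ j = 0"
      using gram_inv_nth by (auto simp: transpose_def gram_inv_def)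
    show "transpose (matrix_inv_on S gram) ** gram = mat_one_on S"
      using arg_cong[OF gram_inv_right, of transpose] by (simp add: matrix_transpose_mul[of gram] t1 t2 gram_inv_def)
    show "gram ** transpose (matrix_inv_on S gram) = mat_one_on S"
      using arg_cong[OF gram_inv_left, of transpose] by (simp add: matrix_transpose_mul[of _ gram] t1 t2 gram_inv_def)
  qed
qed

text \<open>Symmetry of the inverse Gram matrix moves it across the inner product. At \<mu> this
  identifies the target coefficient with the mean of \<open>eta \<bullet> y\<close>.\<close>

lemma inner_eta: "eta X S j \<bullet> u = beta_star X u S $ j"
proof -
  have "eta X S j \<bullet> u = (gram_inv X S *v axis j 1) \<bullet> (transpose (submatrix_cols X S) *v u)"
    unfolding eta_def by (subst inner_commute) (simp add: inner_matrix_vector_mult inner_commute)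
  also have "\<dots> = axis j 1 \<bullet> beta_star X u S"
    unfolding beta_star_def by (subst (2) inner_matrix_vector_mult) (simp add: transpose_gram_inv)
  finally show ?thesis by (simp add: inner_axis' )
qed

lemma eta_nonzero: "j \<in> S \<Longrightarrow> eta X S j \<noteq> 0"
proof
  assume j: "j \<in> S" and "eta X S j = 0"
  then have "gram *v (gram_inv X S *v axis j 1) = 0"
    by (simp add: matrix_vector_mul_assoc[symmetric] eta_def)
  then have "(mat_one_on S *v axis j 1 :: real^'p) $ j = 0"
    by (simp only: matrix_vector_mul_assoc gram_inv_right) simp
  then show False using j by (simp add: mat_one_on_mult_vec)
qed

end

section \<open>The selection event\<close>

lemma finite_constraint_rows: "finite (constraint_rows S)" for S :: "'p::finite set"
proof -
  have "constraint_rows S \<subseteq> case_prod Minus_Row ` UNIV \<union> case_prod Plus_Row ` UNIV \<union> range Sign_Row"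
    by (auto simp: constraint_rows_def)
  then show ?thesis by (rule finite_subset) auto
qed

lemma sign_cases: "s \<in> S \<rightarrow>\<^sub>E {-1, 1} \<Longrightarrow> i \<in> S \<Longrightarrow> s i = -1 \<or> s i = (1::real)"
  by (auto simp: PiE_iff)

lemma marginal_screening_outcome_sign:
  assumes "marginal_screening_outcome X k z (S, s)" "i \<in> S"
  shows "s i * (column i X \<bullet> z) = \<bar>column i X \<bullet> z\<bar>"
  using assms by (cases "column i X \<bullet> z = 0") (auto simp: marginal_screening_outcome_def sgn_mult_self_eq abs_sgn mult.commute)

lemma marginal_screening_outcome_constraint:
  assumes "marginal_screening_outcome X k z (S, s)" "r \<in> constraint_rows S"
  shows "constraint_A X s r \<bullet> z \<le> 0"
proof -
  have "\<bar>column l X \<bullet> z\<bar> \<le> s i * (column i X \<bullet> z)" if "i \<in> S" "l \<notin> S" for i l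
    using assms(1) marginal_screening_outcome_sign[OF assms(1) that(1)] that
    by (auto simp: marginal_screening_outcome_def)
  moreover have "0 \<le> s i * (column i X \<bullet> z)" if "i \<in> S" for i
    using marginal_screening_outcome_sign[OF assms(1) that] by simp
  ultimately show ?thesis
    using assms(2) by (fastforce simp: constraint_rows_def inner_diff_left abs_le_iff)
qed

text \<open>Strict constraints exclude ties and zero correlations, so whatever rule resolves them
  has no choice. An index of \<open>S\<close> missing from \<open>S'\<close> would, by equal
  cardinality, leave an index of \<open>S'\<close> outside \<open>S\<close> with at least as large a
  correlation.\<close>

lemma marginal_screening_outcome_unique:
  assumes strict: "\<And>r. r \<in> constraint_rows S \<Longrightarrow> constraint_A X s r \<bullet> z < 0"
    and S: "card S = k" "s \<in> S \<rightarrow>\<^sub>E {-1, 1}"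
    and out: "marginal_screening_outcome X k z (S', s')"
  shows "S' = S \<and> s' = s"
proof
  have pos: "0 < s i * (column i X \<bullet> z)" if "i \<in> S" for i
    using strict[of "Sign_Row i"] that by (auto simp: constraint_rows_def)
  have abs: "s i * (column i X \<bullet> z) = \<bar>column i X \<bullet> z\<bar>" if "i \<in> S" for i
    using sign_cases[OF S(2) that] pos[OF that] by auto
  have less: "\<bar>column l X \<bullet> z\<bar> < \<bar>column i X \<bullet> z\<bar>" if "i \<in> S" "l \<notin> S" for i l
    using strict[of "Minus_Row l i"] strict[of "Plus_Row l i"] abs[OF that(1)] that
    by (auto simp: constraint_rows_def inner_diff_left abs_less_iff)
  have "S \<subseteq> S'"
  proof (rule ccontr)
    assume "\<not> S \<subseteq> S'"
    then obtain i where i: "i \<in> S" "i \<notin> S'" by auto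
    have "card S' = card S" using S out by (simp add: marginal_screening_outcome_def)
    then have "\<not> S' \<subset> S" using psubset_card_mono[of S S'] by auto
    then obtain l where l: "l \<in> S'" "l \<notin> S" using i by auto
    then have "\<bar>column i X \<bullet> z\<bar> \<le> \<bar>column l X \<bullet> z\<bar>"
      using out i by (auto simp: marginal_screening_outcome_def)
    with less[OF i(1) l(2)] show False by simp
  qed
  then show SS: "S' = S"
    using S out card_subset_eq[of S' S] by (auto simp: marginal_screening_outcome_def)
  show "s' = s"
  proof (rule PiE_ext)
    show "s' \<in> S \<rightarrow>\<^sub>E {-1, 1}" using out SS by (simp add: marginal_screening_outcome_def)
    show "s \<in> S \<rightarrow>\<^sub>E {-1, 1}" by fact
    fix i assume i: "i \<in> S"
    then have "s' i = sgn (column i X \<bullet> z)"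
      using out SS pos[OF i] by (auto simp: marginal_screening_outcome_def)
    also have "\<dots> = s i" using sign_cases[OF S(2) i] pos[OF i] by auto
    finally show "s' i = s i" .
  qed
qed

text \<open>Makes the boundary hyperplanes null sets. A vanishing row would mean two columns equal
  up to sign, or a zero column.\<close>

lemma constraint_A_nonzero:
  fixes X :: "real^'p^'n"
  assumes "general_position X" "\<forall>i. norm (column i X) = 1" "s \<in> S \<rightarrow>\<^sub>E {-1, 1}" "r \<in> constraint_rows S"
  shows "constraint_A X s r \<noteq> 0"
proof -
  have ne: "column i X \<noteq> 0" for i using assms(2) by (metis norm_zero zero_neq_one)
  have dist: "column l X \<noteq> column i X" "column l X \<noteq> - column i X" "column i X \<noteq> - column l X"
    if "l \<notin> S" "i \<in> S" for i l
    using assms(1) that unfolding general_position_def by metis+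
  have eq: "- a - b = 0 \<longleftrightarrow> b = - a" for a b :: "real^'n" by (auto simp: algebra_simps)
  from assms(4) consider i l where "i \<in> S" "l \<notin> S" "r = Minus_Row l i \<or> r = Plus_Row l i"
    | i where "i \<in> S" "r = Sign_Row i"
    by (auto simp: constraint_rows_def)
  then show ?thesis
  proof cases
    case 1
    then show ?thesis
      using dist[of l i] sign_cases[OF assms(3), of i] by (auto simp: eq add_eq_0_iff)
  next
    case 2
    then show ?thesis using ne[of i] sign_cases[OF assms(3), of i] by auto
  qed
qed

section \<open>The truncation limits along a line\<close>

lemma constraint_limit_eq:
  assumes "constraint_c X s h r \<noteq> 0"
  shows "constraint_limit X s h z r = h \<bullet> z - (constraint_A X s r \<bullet> z) / constraint_c X s h r"
  using assms by (simp add: constraint_limit_def constraint_b_def field_simps)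

text \<open>Each limit is \<open>h \<bullet> z\<close> minus the row value divided by
  \<open>constraint_c\<close>, so comparing it with \<open>h \<bullet> z\<close> reads off the sign
  of the row value. Strictness survives the maximum because there are finitely many rows.\<close>

lemma V_minus_less_iff:
  "V_minus X (S, s) h z < ereal (h \<bullet> z) \<longleftrightarrow>
    (\<forall>r\<in>constraint_rows S. constraint_c X s h r < 0 \<longrightarrow> constraint_A X s r \<bullet> z < 0)"
proof -
  define I where "I = {r \<in> constraint_rows S. constraint_c X s h r < 0}"
  have fin: "finite I" using finite_constraint_rows[of S] by (simp add: I_def)
  have V: "V_minus X (S, s) h z = (SUP r\<in>I. ereal (constraint_limit X s h z r))"
    by (simp add: V_minus_def I_def)
  have "V_minus X (S, s) h z < ereal (h \<bullet> z) \<longleftrightarrow> (\<forall>r\<in>I. constraint_limit X s h z r < h \<bullet> z)"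
    using fin by (cases "I = {}") (simp_all add: V finite_Sup_less_iff bot_ereal_def)
  also have "\<dots> \<longleftrightarrow> (\<forall>r\<in>constraint_rows S. constraint_c X s h r < 0 \<longrightarrow> constraint_A X s r \<bullet> z < 0)"
    by (auto simp: I_def constraint_limit_eq zero_less_divide_iff)
  finally show ?thesis .
qed

lemma V_plus_greater_iff:
  "ereal (h \<bullet> z) < V_plus X (S, s) h z \<longleftrightarrow>
    (\<forall>r\<in>constraint_rows S. 0 < constraint_c X s h r \<longrightarrow> constraint_A X s r \<bullet> z < 0)"
proof -
  define I where "I = {r \<in> constraint_rows S. 0 < constraint_c X s h r}"
  have fin: "finite I" using finite_constraint_rows[of S] by (simp add: I_def)
  have V: "V_plus X (S, s) h z = (INF r\<in>I. ereal (constraint_limit X s h z r))"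
    by (simp add: V_plus_def I_def)
  have "ereal (h \<bullet> z) < V_plus X (S, s) h z \<longleftrightarrow> (\<forall>r\<in>I. h \<bullet> z < constraint_limit X s h z r)"
    using fin by (cases "I = {}") (simp_all add: V finite_less_Inf_iff top_ereal_def)
  also have "\<dots> \<longleftrightarrow> (\<forall>r\<in>constraint_rows S. 0 < constraint_c X s h r \<longrightarrow> constraint_A X s r \<bullet> z < 0)"
    by (auto simp: I_def constraint_limit_eq divide_less_0_iff)
  finally show ?thesis .
qed

text \<open>Rows with \<open>constraint_c\<close> equal to 0 do not change along \<open>h\<close>:
  they give no bound on \<open>h \<bullet> z\<close> but may exclude a whole line.\<close>

lemma constraints_strict_iff:
  "(\<forall>r\<in>constraint_rows S. constraint_A X s r \<bullet> z < 0) \<longleftrightarrow>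
    V_minus X (S, s) h z < ereal (h \<bullet> z) \<and> ereal (h \<bullet> z) < V_plus X (S, s) h z \<and>
    (\<forall>r\<in>constraint_rows S. constraint_c X s h r = 0 \<longrightarrow> constraint_A X s r \<bullet> z < 0)"
  unfolding V_minus_less_iff V_plus_greater_iff by (metis linorder_neqE_linordered_idom)

lemma V_bounds:
  assumes "\<And>r. r \<in> constraint_rows S \<Longrightarrow> constraint_A X s r \<bullet> z \<le> 0"
  shows "V_minus X (S, s) h z \<le> ereal (h \<bullet> z)" "ereal (h \<bullet> z) \<le> V_plus X (S, s) h z"
  using assms by (auto simp: V_minus_def V_plus_def constraint_limit_eq zero_le_divide_iff divide_le_0_iff
      intro!: SUP_least INF_greatest)

text \<open>A step \<open>x\<close> changes a row value by \<open>x * constraint_c\<close> and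
  \<open>h \<bullet> z\<close> by \<open>x\<close>, and these cancel in the numerator of the limit.
  Dividing \<open>h\<close> by its squared norm makes the line parameter equal to
  \<open>h \<bullet> z\<close>.\<close>

lemma V_line:
  assumes "h \<noteq> 0" "h \<bullet> u = 0"
  shows "V_minus X E h (u + x *\<^sub>R (h /\<^sub>R (norm h)\<^sup>2)) = V_minus X E h u"
    and "V_plus X E h (u + x *\<^sub>R (h /\<^sub>R (norm h)\<^sup>2)) = V_plus X E h u"
proof -
  have "constraint_limit X s h (u + x *\<^sub>R (h /\<^sub>R (norm h)\<^sup>2)) r = constraint_limit X s h u r"
    if "constraint_c X s h r \<noteq> 0" for s r
    using assms that by (simp add: constraint_limit_def constraint_c_def inner_add_right
        dot_square_norm divide_inverse_commute mult.commute)
  then show "V_minus X E h (u + x *\<^sub>R (h /\<^sub>R (norm h)\<^sup>2)) = V_minus X E h u"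
    "V_plus X E h (u + x *\<^sub>R (h /\<^sub>R (norm h)\<^sup>2)) = V_plus X E h u"
    unfolding V_minus_def V_plus_def by (auto split: prod.split intro!: SUP_cong INF_cong)
qed

section \<open>The normal density along a line, and measurability\<close>

lemma iso_normal_density_eq:
  fixes z \<mu> :: "real^'n"
  assumes "0 < \<sigma>"
  shows "iso_normal_density \<mu> \<sigma> z =
    (1 / sqrt (2 * pi * \<sigma>\<^sup>2)) ^ CARD('n) * exp (- (norm (z - \<mu>))\<^sup>2 / (2 * \<sigma>\<^sup>2))"
proof -
  have "(\<Sum>i\<in>UNIV. - (z $ i - \<mu> $ i)\<^sup>2 / (2 * \<sigma>\<^sup>2)) = - (norm (z - \<mu>))\<^sup>2 / (2 * \<sigma>\<^sup>2)"
    by (simp add: norm_vec_def L2_set_def sum_nonneg sum_negf sum_divide_distrib)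
  then show ?thesis
    by (simp add: iso_normal_density_def normal_density_def prod_dividef exp_sum[symmetric] power_divide)
qed

lemma iso_normal_density_line:
  fixes h \<mu> u :: "real^'n"
  assumes "0 < \<sigma>" "h \<noteq> 0" "h \<bullet> u = 0"
  shows "\<exists>K\<ge>0. \<forall>x. iso_normal_density \<mu> \<sigma> (u + x *\<^sub>R (h /\<^sub>R (norm h)\<^sup>2)) =
    K * normal_density (h \<bullet> \<mu>) (\<sigma> * norm h) x"
proof -
  \<comment> \<open>Result of completing the square in \<open>x\<close>: the exponent contains the
    squared distance from \<mu> to the line. The square root attached below undoes the normalisation
    inside \<open>normal_density\<close>.\<close>
  define C where "C = (1 / sqrt (2 * pi * \<sigma>\<^sup>2)) ^ CARD('n) *
    exp (- ((norm (u - \<mu>))\<^sup>2 - (h \<bullet> \<mu>)\<^sup>2 / (norm h)\<^sup>2) / (2 * \<sigma>\<^sup>2))"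
  have n: "(norm h)\<^sup>2 \<noteq> 0" using assms(2) by simp
  have "iso_normal_density \<mu> \<sigma> (u + x *\<^sub>R (h /\<^sub>R (norm h)\<^sup>2)) =
    (C * sqrt (2 * pi * (\<sigma> * norm h)\<^sup>2)) * normal_density (h \<bullet> \<mu>) (\<sigma> * norm h) x" for x
  proof -
    have "(norm (u + x *\<^sub>R (h /\<^sub>R (norm h)\<^sup>2) - \<mu>))\<^sup>2 =
        (norm (u - \<mu>))\<^sup>2 + 2 * x * (h \<bullet> (u - \<mu>)) / (norm h)\<^sup>2 + x\<^sup>2 * (h \<bullet> h) / ((norm h)\<^sup>2)\<^sup>2"
      unfolding power2_norm_eq_inner[of "u + _ - \<mu>"] power2_norm_eq_inner[of "u - \<mu>"]
      by (simp add: inner_diff inner_add inner_commute divide_inverse power2_eq_square algebra_simps)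
    also have "\<dots> = (norm (u - \<mu>))\<^sup>2 - 2 * x * (h \<bullet> \<mu>) / (norm h)\<^sup>2 + x\<^sup>2 / (norm h)\<^sup>2"
    proof -
      have "a * b / b\<^sup>2 = a / b" for a b :: real by (simp add: power2_eq_square)
      from this[of "x\<^sup>2" "(norm h)\<^sup>2"] show ?thesis
        using assms(3) by (simp only: dot_square_norm inner_diff_right) simp
    qed
    also have "\<dots> = ((norm (u - \<mu>))\<^sup>2 - (h \<bullet> \<mu>)\<^sup>2 / (norm h)\<^sup>2) + (x - h \<bullet> \<mu>)\<^sup>2 / (norm h)\<^sup>2"
      by (simp add: power2_diff diff_divide_distrib add_divide_distrib)
    finally have *: "- (norm (u + x *\<^sub>R (h /\<^sub>R (norm h)\<^sup>2) - \<mu>))\<^sup>2 / (2 * \<sigma>\<^sup>2) =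
        - ((norm (u - \<mu>))\<^sup>2 - (h \<bullet> \<mu>)\<^sup>2 / (norm h)\<^sup>2) / (2 * \<sigma>\<^sup>2) + - (x - h \<bullet> \<mu>)\<^sup>2 / (2 * (\<sigma> * norm h)\<^sup>2)"
      by (simp add: add_divide_distrib diff_divide_distrib power_mult_distrib)
    show ?thesis
      unfolding iso_normal_density_eq[OF assms(1)] * exp_add C_def normal_density_def
      using assms n by simp
  qed
  moreover have "0 \<le> C * sqrt (2 * pi * (\<sigma> * norm h)\<^sup>2)" by (simp add: C_def)
  ultimately show ?thesis by blast
qed

text \<open>Monotone on the reals and patched at the two infinite points. It is composed below with
  truncation limits that vary with \<open>z\<close>.\<close>

lemma borel_measurable_normal_ecdf [measurable]:
  assumes "0 < \<tau>"
  shows "normal_ecdf m \<tau> \<in> borel_measurable borel"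
proof -
  have "mono (\<lambda>x. normal_ecdf m \<tau> (ereal x))"
    by (intro monoI) (simp add: normal_ecdf_le_iff[OF assms])
  then have [measurable]: "(\<lambda>x. normal_ecdf m \<tau> (ereal x)) \<in> borel_measurable borel"
    by (rule borel_measurable_mono)
  have "normal_ecdf m \<tau> = (\<lambda>x. if x = \<infinity> then normal_ecdf m \<tau> \<infinity> else if x = -\<infinity> then normal_ecdf m \<tau> (-\<infinity>)
      else (\<lambda>x. normal_ecdf m \<tau> (ereal x)) (real_of_ereal x))"
    by (auto simp: fun_eq_iff ereal_real)
  also have "\<dots> \<in> borel_measurable borel" by measurable
  finally show ?thesis .
qed

lemma AE_inner_nonzero:
  fixes a :: "'a::euclidean_space"
  assumes "a \<noteq> 0"
  shows "AE z in lborel. a \<bullet> z \<noteq> 0"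
proof -
  have "{z. a \<bullet> z = 0} \<in> null_sets lebesgue"
    using negligible_hyperplane[of a 0] assms by (simp add: negligible_iff_null_sets)
  then have "AE z in lebesgue. a \<bullet> z \<noteq> 0" by (auto dest: AE_not_in)
  then show ?thesis by (simp add: AE_completion_iff)
qed

lemma borel_measurable_constraint_limit [measurable]:
  "(\<lambda>z. constraint_limit X s h z r) \<in> borel_measurable borel"
  unfolding constraint_limit_def by measurable

lemma borel_measurable_V [measurable]:
  "(\<lambda>z. V_minus X E h z) \<in> borel_measurable borel" "(\<lambda>z. V_plus X E h z) \<in> borel_measurable borel"
proof -
  obtain S s where E: "E = (S, s)" by (cases E)
  have [simp]: "countable {r \<in> constraint_rows S. P r}" for P
    using finite_constraint_rows[of S] by (simp add: countable_finite)
  show "(\<lambda>z. V_minus X E h z) \<in> borel_measurable borel"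
    unfolding V_minus_def E prod.case by (intro borel_measurable_SUP) simp_all
  show "(\<lambda>z. V_plus X E h z) \<in> borel_measurable borel"
    unfolding V_plus_def E prod.case by (intro borel_measurable_INF) simp_all
qed

abbreviation feasible :: "real^'p^'n \<Rightarrow> 'p set \<Rightarrow> ('p \<Rightarrow> real) \<Rightarrow> (real^'n) set" where
  "feasible X S s \<equiv> {z. \<forall>r\<in>constraint_rows S. constraint_A X s r \<bullet> z < 0}"

lemma sets_feasible [measurable]: "feasible X S s \<in> sets borel"
proof -
  have "feasible X S s = (\<Inter>r\<in>constraint_rows S. {z. constraint_A X s r \<bullet> z < 0})" by auto
  also have "open \<dots>"
    by (intro open_INT finite_constraint_rows ballI open_Collect_less continuous_intros)
  finally have "open (feasible X S s)" .
  then show ?thesis by simp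
qed

context
  fixes X :: "real^'p^'n" and S :: "'p set" and s :: "'p \<Rightarrow> real" and \<mu> h :: "real^'n" and \<sigma> :: real
  assumes \<sigma>: "0 < \<sigma>" and h: "h \<noteq> 0"
begin

abbreviation "pivot m z \<equiv> trunc_normal_cdf (V_minus X (S, s) h z) (V_plus X (S, s) h z) m (\<sigma>\<^sup>2 * (norm h)\<^sup>2) (h \<bullet> z)"

lemma pivot_scale: "0 < \<sigma> * norm h" "\<sigma>\<^sup>2 * (norm h)\<^sup>2 = (\<sigma> * norm h)\<^sup>2"
  using \<sigma> h by (simp_all add: power_mult_distrib)

lemma borel_measurable_pivot [measurable]: "pivot m \<in> borel_measurable borel"
  unfolding pivot_scale(2) trunc_normal_cdf_ecdf[OF pivot_scale(1)]
  by (intro borel_measurable_divide borel_measurable_diff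
      measurable_compose[OF _ borel_measurable_normal_ecdf[OF pivot_scale(1)]]) measurable

lemma iso_normal_pivot_uniform:
  assumes \<alpha>: "0 < \<alpha>" "\<alpha> < 1"
  shows "(\<integral>\<^sup>+z. ennreal (iso_normal_density \<mu> \<sigma> z) *
      indicator {z\<in>feasible X S s. \<alpha> / 2 \<le> pivot (h \<bullet> \<mu>) z \<and> pivot (h \<bullet> \<mu>) z \<le> 1 - \<alpha> / 2} z \<partial>lborel) =
    ennreal (1 - \<alpha>) * (\<integral>\<^sup>+z. ennreal (iso_normal_density \<mu> \<sigma> z) * indicator (feasible X S s) z \<partial>lborel)"
proof -
  let ?R = "{z\<in>feasible X S s. \<alpha> / 2 \<le> pivot (h \<bullet> \<mu>) z \<and> pivot (h \<bullet> \<mu>) z \<le> 1 - \<alpha> / 2}"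
  let ?k = "h /\<^sub>R (norm h)\<^sup>2"
  let ?N = "normal_measure (h \<bullet> \<mu>) (\<sigma> * norm h)"
  interpret prob_space ?N by (rule prob_space_normal_measure[OF pivot_scale(1)])
  have [measurable]: "iso_normal_density \<mu> \<sigma> \<in> borel_measurable borel"
    unfolding iso_normal_density_def by measurable
  have [measurable]: "?R \<in> sets borel" by measurable
  have line: "(\<integral>\<^sup>+x. ennreal (iso_normal_density \<mu> \<sigma> (u + x *\<^sub>R ?k)) * indicator ?R (u + x *\<^sub>R ?k) \<partial>lborel) =
      ennreal (1 - \<alpha>) * (\<integral>\<^sup>+x. ennreal (iso_normal_density \<mu> \<sigma> (u + x *\<^sub>R ?k)) * indicator (feasible X S s) (u + x *\<^sub>R ?k) \<partial>lborel)"
    if u: "h \<bullet> u = 0" for u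
  proof -
    obtain K where K: "0 \<le> K" "\<And>x. iso_normal_density \<mu> \<sigma> (u + x *\<^sub>R ?k) = K * normal_density (h \<bullet> \<mu>) (\<sigma> * norm h) x"
      using iso_normal_density_line[OF \<sigma> h u] by blast
    define v w where "v = V_minus X (S, s) h u" and "w = V_plus X (S, s) h u"
    have V: "V_minus X (S, s) h (u + x *\<^sub>R ?k) = v" "V_plus X (S, s) h (u + x *\<^sub>R ?k) = w" for x
      using V_line[OF h u] by (simp_all add: v_def w_def)
    have hx: "h \<bullet> (u + x *\<^sub>R ?k) = x" for x
      using h u by (simp add: inner_add_right dot_square_norm)
    \<comment> \<open>\<open>B\<close> collects the rows that are constant on the line; it is
      decided at the base point.\<close>
    define B where "B \<longleftrightarrow> (\<forall>r\<in>constraint_rows S. constraint_c X s h r = 0 \<longrightarrow> constraint_A X s r \<bullet> u < 0)"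
    have B: "(\<forall>r\<in>constraint_rows S. constraint_c X s h r = 0 \<longrightarrow> constraint_A X s r \<bullet> (u + x *\<^sub>R ?k) < 0) \<longleftrightarrow> B" for x
      using h by (auto simp: B_def constraint_c_def inner_add_right)
    have feas: "u + x *\<^sub>R ?k \<in> feasible X S s \<longleftrightarrow> v < ereal x \<and> ereal x < w \<and> B" for x
      using constraints_strict_iff[of S X s "u + x *\<^sub>R ?k" h] by (simp only: mem_Collect_eq V hx B)
    have N: "(\<integral>\<^sup>+x. ennreal (iso_normal_density \<mu> \<sigma> (u + x *\<^sub>R ?k)) * indicator Q x \<partial>lborel) = ennreal K * ennreal (prob Q)"
      if [measurable]: "Q \<in> sets borel" for Q
    proof -
      have "(\<integral>\<^sup>+x. ennreal (iso_normal_density \<mu> \<sigma> (u + x *\<^sub>R ?k)) * indicator Q x \<partial>lborel) =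
        (\<integral>\<^sup>+x. ennreal K * (ennreal (normal_density (h \<bullet> \<mu>) (\<sigma> * norm h) x) * indicator Q x) \<partial>lborel)"
        unfolding K(2) using K(1) by (simp add: ennreal_mult mult.assoc)
      also have "\<dots> = ennreal K * emeasure ?N Q"
        by (subst nn_integral_cmult) (auto simp: normal_measure_def emeasure_density)
      finally show ?thesis by (simp add: emeasure_eq_measure)
    qed
    show ?thesis
    \<comment> \<open>If \<open>B\<close> fails or the interval is empty, the line misses the
      polyhedron and both integrals are 0. Otherwise the one-dimensional uniformity applies and
      \<open>K\<close> is common to both sides.\<close>
    proof (cases "B \<and> v < w")
      case True
      let ?F = "trunc_normal_cdf v w (h \<bullet> \<mu>) ((\<sigma> * norm h)\<^sup>2)"
      let ?Q1 = "{x. v < ereal x \<and> ereal x < w \<and> \<alpha> / 2 \<le> ?F x \<and> ?F x \<le> 1 - \<alpha> / 2}"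
      let ?Q = "{x. v < ereal x \<and> ereal x < w}"
      have [measurable]: "?F \<in> borel_measurable borel"
        unfolding trunc_normal_cdf_ecdf[OF pivot_scale(1)]
        by (intro borel_measurable_divide borel_measurable_diff
            measurable_compose[OF _ borel_measurable_normal_ecdf[OF pivot_scale(1)]]) measurable
      have 1: "indicator ?R (u + x *\<^sub>R ?k) = (indicator ?Q1 x :: ennreal)" for x
        using True feas[of x] by (simp only: indicator_def mem_Collect_eq V hx pivot_scale(2)) auto
      have 2: "indicator (feasible X S s) (u + x *\<^sub>R ?k) = (indicator ?Q x :: ennreal)" for x
        using True feas[of x] by (simp only: indicator_def mem_Collect_eq) auto
      have "prob ?Q1 = (1 - \<alpha>) * prob ?Q"
        using trunc_normal_cdf_uniform[OF pivot_scale(1), of v w "\<alpha> / 2" "1 - \<alpha> / 2" "h \<bullet> \<mu>"] True \<alpha> by simp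
      then show ?thesis
        unfolding 1 2 using \<alpha> by (subst (1 2) N) (auto simp: ennreal_mult mult_ac)
    next
      case False
      then have no: "u + x *\<^sub>R ?k \<notin> feasible X S s" for x
        unfolding feas by (auto dest: order.strict_trans)
      have "indicator ?R (u + x *\<^sub>R ?k) = (0::ennreal)" "indicator (feasible X S s) (u + x *\<^sub>R ?k) = (0::ennreal)" for x
        using no[of x] by (simp_all only: indicator_def mem_Collect_eq) auto
      then show ?thesis by simp
    qed
  qed
  have "(\<integral>\<^sup>+z. ennreal (iso_normal_density \<mu> \<sigma> z) * indicator ?R z \<partial>lborel) =
      (\<integral>\<^sup>+z. ennreal (1 - \<alpha>) * (ennreal (iso_normal_density \<mu> \<sigma> z) * indicator (feasible X S s) z) \<partial>lborel)"
  proof (rule nn_integral_lborel_eqI_lines[of _ _ ?k])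
    show "?k \<noteq> 0" using h by simp
    fix u assume "?k \<bullet> u = 0"
    then have "h \<bullet> u = 0" using h by simp
    note line[OF this]
    also have "ennreal (1 - \<alpha>) * (\<integral>\<^sup>+x. ennreal (iso_normal_density \<mu> \<sigma> (u + x *\<^sub>R ?k)) * indicator (feasible X S s) (u + x *\<^sub>R ?k) \<partial>lborel) =
      (\<integral>\<^sup>+x. ennreal (1 - \<alpha>) * (ennreal (iso_normal_density \<mu> \<sigma> (u + x *\<^sub>R ?k)) * indicator (feasible X S s) (u + x *\<^sub>R ?k)) \<partial>lborel)"
      by (rule nn_integral_cmult[symmetric]) measurable
    finally show "(\<integral>\<^sup>+x. ennreal (iso_normal_density \<mu> \<sigma> (u + x *\<^sub>R ?k)) * indicator ?R (u + x *\<^sub>R ?k) \<partial>lborel) = \<dots>" .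
  qed measurable
  also have "\<dots> = ennreal (1 - \<alpha>) * (\<integral>\<^sup>+z. ennreal (iso_normal_density \<mu> \<sigma> z) * indicator (feasible X S s) z \<partial>lborel)"
    by (rule nn_integral_cmult) measurable
  finally show ?thesis .
qed

end

section \<open>Confidence limits\<close>

text \<open>The numerator is 0 or equals the denominator. When the interval degenerates at
  \<open>t = w\<close> the quotient is 0 / 0, which is 0, so the value stays in {0, 1}.\<close>

lemma trunc_normal_cdf_endpoint:
  assumes "0 < \<tau>" "v = ereal t \<or> ereal t = w"
  shows "trunc_normal_cdf v w m (\<tau>\<^sup>2) t = 0 \<or> trunc_normal_cdf v w m (\<tau>\<^sup>2) t = 1"
  unfolding trunc_normal_cdf_ecdf[OF assms(1)] using assms(2) by auto

context
  fixes X :: "real^'p^'n" and S :: "'p set" and s :: "'p \<Rightarrow> real" and j :: 'p and z :: "real^'n" and \<sigma> :: real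
  assumes \<sigma>: "0 < \<sigma>" and eta: "eta X S j \<noteq> 0"
begin

lemma pivot_eq_iff:
  "pivot_eq X \<sigma> (S, s) j z q m \<longleftrightarrow>
    trunc_normal_cdf (V_minus X (S, s) (eta X S j) z) (V_plus X (S, s) (eta X S j) z) m
      ((\<sigma> * norm (eta X S j))\<^sup>2) (eta X S j \<bullet> z) = q"
  by (simp add: pivot_eq_def Let_def power_mult_distrib)

lemma pivot_eq_ex1:
  assumes "V_minus X (S, s) (eta X S j) z < ereal (eta X S j \<bullet> z)"
    "ereal (eta X S j \<bullet> z) < V_plus X (S, s) (eta X S j) z" "0 < q" "q < 1"
  shows "\<exists>!m. pivot_eq X \<sigma> (S, s) j z q m"
  unfolding pivot_eq_iff using trunc_normal_cdf_mean_ex1[OF _ assms] \<sigma> eta by simp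

text \<open>The pivot decreases in the mean, so the lower limit belongs to the upper level; coverage
  then follows from order alone.\<close>

lemma confidence_interval_iff:
  assumes strict: "V_minus X (S, s) (eta X S j) z < ereal (eta X S j \<bullet> z)"
    "ereal (eta X S j \<bullet> z) < V_plus X (S, s) (eta X S j) z" and \<alpha>: "0 < \<alpha>" "\<alpha> < 1"
  shows "b \<in> {L_limit X \<sigma> \<alpha> (S, s) j z..U_limit X \<sigma> \<alpha> (S, s) j z} \<longleftrightarrow>
    \<alpha> / 2 \<le> pivot X S s (eta X S j) \<sigma> b z \<and> pivot X S s (eta X S j) \<sigma> b z \<le> 1 - \<alpha> / 2"
proof -
  define F where "F m = pivot X S s (eta X S j) \<sigma> m z" for m
  have pivot_eq_F: "pivot_eq X \<sigma> (S, s) j z q m \<longleftrightarrow> F m = q" for q m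
    by (simp add: pivot_eq_iff F_def power_mult_distrib)
  have "0 < \<sigma> * norm (eta X S j)" using \<sigma> eta by simp
  from trunc_normal_cdf_mean_le_iff[OF this strict]
  have mono: "F m' \<le> F m \<longleftrightarrow> m \<le> m'" for m m'
    by (simp add: F_def power_mult_distrib)
  have "pivot_eq X \<sigma> (S, s) j z (1 - \<alpha> / 2) (L_limit X \<sigma> \<alpha> (S, s) j z)"
    unfolding L_limit_def by (rule theI'[OF pivot_eq_ex1[OF strict]]) (use \<alpha> in auto)
  then have L: "F (L_limit X \<sigma> \<alpha> (S, s) j z) = 1 - \<alpha> / 2" by (simp only: pivot_eq_F)
  have "pivot_eq X \<sigma> (S, s) j z (\<alpha> / 2) (U_limit X \<sigma> \<alpha> (S, s) j z)"
    unfolding U_limit_def by (rule theI'[OF pivot_eq_ex1[OF strict]]) (use \<alpha> in auto)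
  then have U: "F (U_limit X \<sigma> \<alpha> (S, s) j z) = \<alpha> / 2" by (simp only: pivot_eq_F)
  show ?thesis
    using mono[of b "L_limit X \<sigma> \<alpha> (S, s) j z"] mono[of "U_limit X \<sigma> \<alpha> (S, s) j z" b]
    by (auto simp: L U F_def[symmetric])
qed

text \<open>
  At an endpoint of the truncation interval no mean solves the pivot equations, so both limits are
  the same junk value of \<^const>\<open>The\<close>.  This null event still has to be measurable, as \<open>M\<close> need not
  be complete.
\<close>
lemma limits_eq_if_endpoint:
  assumes le: "V_minus X (S, s) (eta X S j) z \<le> ereal (eta X S j \<bullet> z)"
    "ereal (eta X S j \<bullet> z) \<le> V_plus X (S, s) (eta X S j) z"
    and not_strict: "\<not> (V_minus X (S, s) (eta X S j) z < ereal (eta X S j \<bullet> z) \<and>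
      ereal (eta X S j \<bullet> z) < V_plus X (S, s) (eta X S j) z)"
    and \<alpha>: "0 < \<alpha>" "\<alpha> < 1"
  shows "L_limit X \<sigma> \<alpha> (S, s) j z = (THE m. False)" "U_limit X \<sigma> \<alpha> (S, s) j z = (THE m. False)"
proof -
  have "0 < \<sigma> * norm (eta X S j)" using \<sigma> eta by simp
  note trunc_normal_cdf_endpoint[OF this, of "V_minus X (S, s) (eta X S j) z" "eta X S j \<bullet> z" "V_plus X (S, s) (eta X S j) z"]
  moreover have "V_minus X (S, s) (eta X S j) z = ereal (eta X S j \<bullet> z) \<or> ereal (eta X S j \<bullet> z) = V_plus X (S, s) (eta X S j) z"
    using le not_strict by auto
  ultimately have no: "pivot_eq X \<sigma> (S, s) j z q = (\<lambda>m. False)" if "0 < q" "q < 1" for q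
    unfolding fun_eq_iff pivot_eq_iff using that by (metis less_irrefl)
  show "L_limit X \<sigma> \<alpha> (S, s) j z = (THE m. False)" "U_limit X \<sigma> \<alpha> (S, s) j z = (THE m. False)"
    unfolding L_limit_def U_limit_def using \<alpha> by (simp_all add: no)
qed

end

lemma AE_constraints_nonzero:
  assumes "general_position X" "\<forall>i. norm (column i X) = 1" "s \<in> S \<rightarrow>\<^sub>E {-1, 1}"
  shows "AE z in lborel. \<forall>r\<in>constraint_rows S. constraint_A X s r \<bullet> z \<noteq> 0"
  using constraint_A_nonzero[OF assms] finite_constraint_rows[of S]
  by (intro AE_finite_allI AE_inner_nonzero) auto

lemma marginal_screening_outcome_strict:
  assumes "marginal_screening_outcome X k z (S, s)"
    and "\<forall>r\<in>constraint_rows S. constraint_A X s r \<bullet> z \<noteq> 0"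
  shows "\<forall>r\<in>constraint_rows S. constraint_A X s r \<bullet> z < 0"
  using marginal_screening_outcome_constraint[OF assms(1)] assms(2) by (auto simp: less_le)

theorem corollary6p2:
  fixes M :: "'a measure"
    and X :: "real^'p^'n"
    and \<mu> :: "real^'n"
    and y :: "'a \<Rightarrow> real^'n"
    and \<sigma> \<alpha> :: real
    and k :: nat
    and Ehat :: "real^'n \<Rightarrow> 'p set \<times> ('p \<Rightarrow> real)"
  assumes "prob_space M"
    and "\<forall>i. norm (column i X) = 1"
    and "general_position X"
    and "0 < \<sigma>"
    and "distributed M lborel y (\<lambda>z. ennreal (iso_normal_density \<mu> \<sigma> z))"
    and "1 \<le> k" and "k \<le> min CARD('n) CARD('p)"
    and "Ehat \<in> borel \<rightarrow>\<^sub>M count_space UNIV"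
    and "\<forall>z. marginal_screening_outcome X k z (Ehat z)"
    and "0 < \<alpha>" and "\<alpha> < 1"
  shows "(AE \<omega> in M. \<forall>j \<in> fst (Ehat (y \<omega>)).
            (\<exists>!L. pivot_eq X \<sigma> (Ehat (y \<omega>)) j (y \<omega>) (1 - \<alpha> / 2) L) \<and>
            (\<exists>!U. pivot_eq X \<sigma> (Ehat (y \<omega>)) j (y \<omega>) (\<alpha> / 2) U)) \<and>
         (\<forall>S s. \<P>(\<omega> in M. Ehat (y \<omega>) = (S, s)) > 0 \<longrightarrow>
            (\<forall>j\<in>S.
               \<P>(\<omega> in M. beta_star X \<mu> (fst (Ehat (y \<omega>))) $ j
                           \<in> {L_limit X \<sigma> \<alpha> (Ehat (y \<omega>)) j (y \<omega>)..
                              U_limit X \<sigma> \<alpha> (Ehat (y \<omega>)) j (y \<omega>)}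
                         \<bar> Ehat (y \<omega>) = (S, s)) = 1 - \<alpha>))"
proof -
  interpret M: prob_space M by fact
  have y [measurable]: "y \<in> M \<rightarrow>\<^sub>M borel"
    using distributed_measurable[OF assms(5)] by simp
  have [measurable]: "(\<lambda>z. ennreal (iso_normal_density \<mu> \<sigma> z)) \<in> borel_measurable borel"
    using distributed_borel_measurable[OF assms(5)] by simp
  define P where "P = distr M borel y"
  have sets_P [measurable_cong, simp]: "sets P = sets borel" by (simp add: P_def)
  have "P = distr M lborel y" unfolding P_def by (rule distr_cong) auto
  then have P: "P = density lborel (\<lambda>z. ennreal (iso_normal_density \<mu> \<sigma> z))"
    using distributed_distr_eq_density[OF assms(5)] by simp
  interpret P: prob_space P unfolding P_def by (rule M.prob_space_distr) simp
  have AE_P: "AE z in P. Q z" if "AE z in lborel. Q z" for Q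
    unfolding P using that by (subst AE_density) auto
  have prob: "measure M {\<omega> \<in> space M. Q (y \<omega>)} = P.prob {z. Q z}" if "{z. Q z} \<in> sets borel" for Q
    unfolding P_def using that by (subst measure_distr) (auto intro!: arg_cong[where f="measure M"])
  have em: "emeasure P A = (\<integral>\<^sup>+z. ennreal (iso_normal_density \<mu> \<sigma> z) * indicator A z \<partial>lborel)"
    if "A \<in> sets borel" for A
    unfolding P using that by (subst emeasure_density) auto
  have out: "marginal_screening_outcome X k z (S, s)" if "Ehat z = (S, s)" for z S s
    using assms(9) that by metis
  have out_card: "card S = k" "s \<in> S \<rightarrow>\<^sub>E {-1, 1}" if "Ehat z = (S, s)" for z S s
    using out[OF that] by (auto simp: marginal_screening_outcome_def)
  have eta: "eta X S j \<noteq> 0" if "card S = k" "j \<in> S" for S j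
    using eta_nonzero[OF assms(3) _ that(2)] assms(7) that(1) by simp
  have nonzero: "AE z in P. \<forall>r\<in>constraint_rows S. constraint_A X s r \<bullet> z \<noteq> 0" if "s \<in> S \<rightarrow>\<^sub>E {-1, 1}" for S s
    by (intro AE_P AE_constraints_nonzero[OF assms(3,2) that])

  have "AE z in P. \<forall>j \<in> fst (Ehat z).
            (\<exists>!L. pivot_eq X \<sigma> (Ehat z) j z (1 - \<alpha> / 2) L) \<and> (\<exists>!U. pivot_eq X \<sigma> (Ehat z) j z (\<alpha> / 2) U)"
  proof -
    \<comment> \<open>\<open>Ehat z\<close> varies with \<open>z\<close>, so one null set has to
      serve all outcomes; there are finitely many.\<close>
    have "AE z in P. \<forall>S. \<forall>s\<in>S \<rightarrow>\<^sub>E {-1, 1}. \<forall>r\<in>constraint_rows S. constraint_A X s r \<bullet> z \<noteq> 0"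
      unfolding AE_all_countable
      by (intro allI AE_finite_allI[OF _ nonzero] finite_PiE) auto
    then show ?thesis
    proof eventually_elim
      case (elim z)
      obtain S s where E: "Ehat z = (S, s)" by (cases "Ehat z")
      have "\<forall>r\<in>constraint_rows S. constraint_A X s r \<bullet> z < 0"
        using marginal_screening_outcome_strict[OF out[OF E]] elim out_card[OF E] by blast
      then have strict: "V_minus X (S, s) h z < ereal (h \<bullet> z)" "ereal (h \<bullet> z) < V_plus X (S, s) h z" for h
        using constraints_strict_iff[of S X s z h] by blast+
      show ?case
        unfolding E fst_conv using assms(10,11)
        by (intro ballI conjI pivot_eq_ex1 strict assms(4) eta out_card[OF E]) auto
    qed
  qed
  then have 1: "AE \<omega> in M. \<forall>j \<in> fst (Ehat (y \<omega>)).
            (\<exists>!L. pivot_eq X \<sigma> (Ehat (y \<omega>)) j (y \<omega>) (1 - \<alpha> / 2) L) \<and>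
            (\<exists>!U. pivot_eq X \<sigma> (Ehat (y \<omega>)) j (y \<omega>) (\<alpha> / 2) U)"
    unfolding P_def by (rule AE_distrD[OF y])

  have 2: "\<P>(\<omega> in M. beta_star X \<mu> (fst (Ehat (y \<omega>))) $ j
       \<in> {L_limit X \<sigma> \<alpha> (Ehat (y \<omega>)) j (y \<omega>)..U_limit X \<sigma> \<alpha> (Ehat (y \<omega>)) j (y \<omega>)}
       \<bar> Ehat (y \<omega>) = (S, s)) = 1 - \<alpha>"
    if pos: "\<P>(\<omega> in M. Ehat (y \<omega>) = (S, s)) > 0" and j: "j \<in> S" for S s j
  proof -
    \<comment> \<open>Positive probability forces the outcome to occur, and an outcome that occurs
      has the right size and a genuine sign vector.\<close>
    have "\<exists>\<omega>\<in>space M. Ehat (y \<omega>) = (S, s)"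
      using pos by (metis (mono_tags, lifting) empty_Collect_eq less_irrefl measure_empty)
    then have S: "card S = k" "s \<in> S \<rightarrow>\<^sub>E {-1, 1}" using out_card by blast+
    define h where "h = eta X S j"
    have h: "h \<noteq> 0" unfolding h_def by (rule eta[OF S(1) j])
    have beta: "beta_star X \<mu> S $ j = h \<bullet> \<mu>"
      using inner_eta[OF assms(3), of S j \<mu>] assms(7) S(1) by (simp add: h_def)
    let ?feasible = "feasible X S s"
    define pv where "pv z = pivot X S s h \<sigma> (h \<bullet> \<mu>) z" for z
    let ?ok = "\<lambda>z. \<alpha> / 2 \<le> pv z \<and> pv z \<le> 1 - \<alpha> / 2"
    define strict where "strict z \<longleftrightarrow> V_minus X (S, s) h z < ereal (h \<bullet> z) \<and> ereal (h \<bullet> z) < V_plus X (S, s) h z" for z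
    define cover where "cover z \<longleftrightarrow> h \<bullet> \<mu> \<in> {L_limit X \<sigma> \<alpha> (S, s) j z..U_limit X \<sigma> \<alpha> (S, s) j z}" for z
    have [measurable]: "pv \<in> borel_measurable borel"
      unfolding pv_def by (rule borel_measurable_pivot[OF assms(4) h])
    note [measurable] = assms(8) sets_feasible
    have strict_cover: "cover z \<longleftrightarrow> ?ok z" if "strict z" for z
      using confidence_interval_iff[OF assms(4) eta[OF S(1) j], of s z \<alpha> "h \<bullet> \<mu>"] that assms(10,11)
      by (simp add: cover_def strict_def h_def pv_def)
    have nonstrict_cover: "cover z \<longleftrightarrow> h \<bullet> \<mu> = (THE m. False)" if "\<not> strict z" "Ehat z = (S, s)" for z
    proof -
      have "V_minus X (S, s) h z \<le> ereal (h \<bullet> z)" "ereal (h \<bullet> z) \<le> V_plus X (S, s) h z"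
        by (intro V_bounds marginal_screening_outcome_constraint[OF out[OF that(2)]]; assumption)+
      from limits_eq_if_endpoint[OF assms(4) eta[OF S(1) j] this[unfolded h_def] that(1)[unfolded strict_def h_def] assms(10,11)]
      show ?thesis by (auto simp: cover_def)
    qed
    have feasible_strict: "strict z" if "z \<in> ?feasible" for z
      using that constraints_strict_iff[of S X s z h] by (simp add: strict_def)
    have feasible_Ehat: "Ehat z = (S, s)" if "z \<in> ?feasible" for z
    proof -
      obtain S' s' where E: "Ehat z = (S', s')" by (cases "Ehat z")
      then show ?thesis using marginal_screening_outcome_unique[OF _ S out[OF E]] that by simp
    qed
    have [measurable]: "Measurable.pred borel (\<lambda>z. Ehat z = (S, s))"
      using measurable_compose[OF assms(8), of "\<lambda>e. e = (S, s)" "count_space UNIV"] by simp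
    have [measurable]: "Measurable.pred borel strict" unfolding strict_def by measurable
    \<comment> \<open>Removes the definite descriptions: where the limits solve their equations
      coverage is a condition on the pivot, elsewhere on the outcome its truth value does not depend
      on \<open>z\<close>. The right-hand side is visibly measurable.\<close>
    have "(\<lambda>z. Ehat z = (S, s) \<and> cover z) =
        (\<lambda>z. Ehat z = (S, s) \<and> (if strict z then ?ok z else h \<bullet> \<mu> = (THE m. False)))"
      using strict_cover nonstrict_cover by (auto simp: fun_eq_iff)
    also have "Measurable.pred borel \<dots>" by measurable
    finally have [measurable]: "Measurable.pred borel (\<lambda>z. Ehat z = (S, s) \<and> cover z)" .
    have AE_feasible: "AE z in P. Ehat z = (S, s) \<longleftrightarrow> z \<in> ?feasible"
      using nonzero[OF S(2)]
    proof eventually_elim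
      case (elim z)
      then show ?case
        using marginal_screening_outcome_strict[OF out, of z S s] feasible_Ehat[of z] by auto
    qed
    have ok_sets [measurable]: "{z\<in>?feasible. ?ok z} \<in> sets borel" by measurable
    have "emeasure P {z\<in>?feasible. ?ok z} = ennreal (1 - \<alpha>) * emeasure P ?feasible"
      using iso_normal_pivot_uniform[OF assms(4) h assms(10,11), where X = X and S = S and s = s and \<mu> = \<mu>]
      unfolding pv_def[symmetric] em[OF ok_sets] em[OF sets_feasible] .
    then have scaled: "P.prob {z\<in>?feasible. ?ok z} = (1 - \<alpha>) * P.prob ?feasible"
      using assms(11) by (simp add: P.emeasure_eq_measure ennreal_mult[symmetric])
    have "\<P>(\<omega> in M. Ehat (y \<omega>) = (S, s)) = P.prob {z. Ehat z = (S, s)}"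
      by (rule prob) measurable
    also have "\<dots> = P.prob ?feasible"
      using AE_feasible by (intro measure_eq_AE) auto
    finally have den: "\<P>(\<omega> in M. Ehat (y \<omega>) = (S, s)) = P.prob ?feasible" .
    have "\<P>(\<omega> in M. Ehat (y \<omega>) = (S, s) \<and> cover (y \<omega>)) = P.prob {z. Ehat z = (S, s) \<and> cover z}"
      by (rule prob) measurable
    also have "\<dots> = P.prob {z\<in>?feasible. ?ok z}"
    proof (rule measure_eq_AE)
      show "AE z in P. z \<in> {z. Ehat z = (S, s) \<and> cover z} \<longleftrightarrow> z \<in> {z\<in>?feasible. ?ok z}"
        using AE_feasible by eventually_elim (use feasible_strict strict_cover in blast)
    qed measurable
    finally have num: "\<P>(\<omega> in M. Ehat (y \<omega>) = (S, s) \<and> cover (y \<omega>)) = (1 - \<alpha>) * P.prob ?feasible"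
      using scaled by simp
    have "{\<omega>\<in>space M. beta_star X \<mu> (fst (Ehat (y \<omega>))) $ j
         \<in> {L_limit X \<sigma> \<alpha> (Ehat (y \<omega>)) j (y \<omega>)..U_limit X \<sigma> \<alpha> (Ehat (y \<omega>)) j (y \<omega>)} \<and> Ehat (y \<omega>) = (S, s)} =
       {\<omega>\<in>space M. Ehat (y \<omega>) = (S, s) \<and> cover (y \<omega>)}"
      by (auto simp: cover_def beta)
    then show ?thesis
      unfolding cond_prob_def using num den pos by simp
  qed
  show ?thesis using 1 2 by blast
qed

end
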